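(* Let $p>1$ and let $h$ be non-negative on $C_c(X)$. Then the following statements are equivalent: (i) $h$ is critical in $X$. (ii) For no $x\in X$ does there exist a normalised Green's function in $X$ at $x$. (iii) There exists a global minimal positive harmonic function in $X$. (iv) $\operatorname{cap}_h(x,X)=0$ for some $x\in X$.
   Context: $X$ is a countably infinite set, $m\colon X\to(0,\infty)$, and $b\colon X\times X\to[0,\infty)$ is symmetric with zero diagonal and $\sum_{y\in X}b(x,y)<\infty$ for every $x\in X$. Write $x\sim y$ if $b(x,y)>0$. A set $V\subseteq X$ is connected if any two of its points are joined by a path $x_0\sim x_1\sim\dots\sim x_n$ inside $V$. The graph is assumed connected, i.e. $X$ is connected. $c\colon X\to\mathbb R$ is an arbitrary function. $C(X)$ is the set of real functions on $X$; $C_c(X)$ is the set of finitely supported ones. For $a\in\mathbb R$ put $a^{\langle p-1\rangle}=|a|^{p-1}\operatorname{sgn}(a)$. For $V\subseteq X$, $F(V)=\{f\in C(X):\sum_{y\in X}b(x,y)|f(y)|^{p-1}<\infty\ \forall x\in V\}$, and for $f\in F(V)$, $x\in V$, $$Hf(x)=\frac1{m(x)}\sum_{y\in X}b(x,y)\,(f(x)-f(y))^{\langle p-1\rangle}+\frac{c(x)}{m(x)}f(x)^{\langle p-1\rangle}.$$ A function $u\in F(V)$ is harmonic (superharmonic) on $V$ if $Hu=0$ ($Hu\ge0$) on $V$. "Positive" means $\ge 0$ and not identically $0$. The energy functional is $h(\varphi)=\frac12\sum_{x,y\in X}b(x,y)|\varphi(x)-\varphi(y)|^p+\sum_{x\in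 X}c(x)|\varphi(x)|^p$ for $\varphi\in C_c(X)$. If $h\ge0$ on $C_c(X)$, then $h$ is subcritical in $X$ if there is a positive function $w$ on $X$ such that $h(\varphi)\ge\sum_{x\in X}|\varphi(x)|^pw(x)$ for all $\varphi\in C_c(X)$; otherwise $h$ is critical in $X$. The variational capacity is $\operatorname{cap}_h(x,X)=\inf\{h(\varphi):\varphi\in C_c(X),\ \varphi(x)=1\}$. Minimal growth: for finite $K\subseteq X$ (possibly empty), $\mathcal M(X\setminus K)$ is the set of positive functions $u\in F(X\setminus K)$ that are harmonic on $X\setminus K$ and such that for every nonempty finite connected $\tilde K\subseteq X$ with $K\subseteq\tilde K$ and every positive function $v\in F(X\setminus\tilde K)$ that is superharmonic in $X\setminus\tilde K$: if $u\le v$ on $\tilde K$, then $u\le v$ on $X\setminus\tilde K$. A global minimal positive harmonic function in $X$ is an element of $\mathcal M(X)$ (the case $K=\emptyset$). A normalised Green's function in $X$ at $o\in X$ is a function $u\in\mathcal M(X\setminus\{o\})\cap F(X)$ with $Hu=1_o$ on $X$, where $1_o$ is the indicator function of $\{o\}$. *)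

theory Defs
  imports "HOL-Analysis.Analysis"
begin

text \<open>
  The vertex set \<open>X\<close> is the whole (countably infinite) type \<open>'a\<close>. Sums over \<open>X\<close> are
  \<^const>\<open>infsum\<close> over \<^const>\<open>UNIV\<close>, which is \<open>0\<close> on families that are not summable; the
  operator and the energy below are only used for arguments where the sums converge absolutely.
\<close>

definition connected_in :: "('a \<Rightarrow> 'a \<Rightarrow> real) \<Rightarrow> 'a set \<Rightarrow> bool" where
  "connected_in b V \<longleftrightarrow>
     (\<forall>x\<in>V. \<forall>y\<in>V. (\<lambda>s t. s \<in> V \<and> t \<in> V \<and> b s t > 0)\<^sup>*\<^sup>* x y)"

definition weighted_graph :: "('a \<Rightarrow> real) \<Rightarrow> ('a \<Rightarrow> 'a \<Rightarrow> real) \<Rightarrow> bool" where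
  "weighted_graph m b \<longleftrightarrow>
     countable (UNIV :: 'a set) \<and> infinite (UNIV :: 'a set) \<and>
     (\<forall>x. m x > 0) \<and>
     (\<forall>x y. b x y \<ge> 0) \<and>
     (\<forall>x y. b x y = b y x) \<and>
     (\<forall>x. b x x = 0) \<and>
     (\<forall>x. (\<lambda>y. b x y) summable_on UNIV) \<and>
     connected_in b UNIV"

definition spow :: "real \<Rightarrow> real \<Rightarrow> real" where
  "spow a q = \<bar>a\<bar> powr q * sgn a"

definition positive_fun :: "('a \<Rightarrow> real) \<Rightarrow> bool" where
  "positive_fun f \<longleftrightarrow> (\<forall>x. f x \<ge> 0) \<and> (\<exists>x. f x \<noteq> 0)"

definition Cc :: "('a \<Rightarrow> real) set" where
  "Cc = {f. finite {x. f x \<noteq> 0}}"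

definition formal_domain :: "real \<Rightarrow> ('a \<Rightarrow> 'a \<Rightarrow> real) \<Rightarrow> 'a set \<Rightarrow> ('a \<Rightarrow> real) set" where
  "formal_domain p b V =
     {f. \<forall>x\<in>V. (\<lambda>y. b x y * \<bar>f y\<bar> powr (p - 1)) summable_on UNIV}"

text \<open>Meaningful at \<open>x\<close> when \<open>f \<in> formal_domain p b V\<close> for some \<open>V\<close> containing \<open>x\<close>.\<close>

definition schroedinger_op ::
  "real \<Rightarrow> ('a \<Rightarrow> real) \<Rightarrow> ('a \<Rightarrow> 'a \<Rightarrow> real) \<Rightarrow> ('a \<Rightarrow> real) \<Rightarrow> ('a \<Rightarrow> real) \<Rightarrow> 'a \<Rightarrow> real" where
  "schroedinger_op p m b c f x =
     1 / m x * (\<Sum>\<^sub>\<infinity>y\<in>UNIV. b x y * spow (f x - f y) (p - 1)) +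
     c x / m x * spow (f x) (p - 1)"

definition harmonic_on ::
  "real \<Rightarrow> ('a \<Rightarrow> real) \<Rightarrow> ('a \<Rightarrow> 'a \<Rightarrow> real) \<Rightarrow> ('a \<Rightarrow> real) \<Rightarrow> 'a set \<Rightarrow> ('a \<Rightarrow> real) \<Rightarrow> bool" where
  "harmonic_on p m b c V u \<longleftrightarrow>
     u \<in> formal_domain p b V \<and> (\<forall>x\<in>V. schroedinger_op p m b c u x = 0)"

definition superharmonic_on ::
  "real \<Rightarrow> ('a \<Rightarrow> real) \<Rightarrow> ('a \<Rightarrow> 'a \<Rightarrow> real) \<Rightarrow> ('a \<Rightarrow> real) \<Rightarrow> 'a set \<Rightarrow> ('a \<Rightarrow> real) \<Rightarrow> bool" where
  "superharmonic_on p m b c V u \<longleftrightarrow>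
     u \<in> formal_domain p b V \<and> (\<forall>x\<in>V. schroedinger_op p m b c u x \<ge> 0)"

definition energy ::
  "real \<Rightarrow> ('a \<Rightarrow> 'a \<Rightarrow> real) \<Rightarrow> ('a \<Rightarrow> real) \<Rightarrow> ('a \<Rightarrow> real) \<Rightarrow> real" where
  "energy p b c \<phi> =
     1 / 2 * (\<Sum>\<^sub>\<infinity>(x, y)\<in>UNIV. b x y * \<bar>\<phi> x - \<phi> y\<bar> powr p) +
     (\<Sum>\<^sub>\<infinity>x\<in>UNIV. c x * \<bar>\<phi> x\<bar> powr p)"

definition energy_nonneg :: "real \<Rightarrow> ('a \<Rightarrow> 'a \<Rightarrow> real) \<Rightarrow> ('a \<Rightarrow> real) \<Rightarrow> bool" where
  "energy_nonneg p b c \<longleftrightarrow> (\<forall>\<phi>\<in>Cc. energy p b c \<phi> \<ge> 0)"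

definition subcritical :: "real \<Rightarrow> ('a \<Rightarrow> 'a \<Rightarrow> real) \<Rightarrow> ('a \<Rightarrow> real) \<Rightarrow> bool" where
  "subcritical p b c \<longleftrightarrow>
     energy_nonneg p b c \<and>
     (\<exists>w. positive_fun w \<and>
          (\<forall>\<phi>\<in>Cc. energy p b c \<phi> \<ge> (\<Sum>\<^sub>\<infinity>x\<in>UNIV. \<bar>\<phi> x\<bar> powr p * w x)))"

definition critical :: "real \<Rightarrow> ('a \<Rightarrow> 'a \<Rightarrow> real) \<Rightarrow> ('a \<Rightarrow> real) \<Rightarrow> bool" where
  "critical p b c \<longleftrightarrow> energy_nonneg p b c \<and> \<not> subcritical p b c"

text \<open>The infimum is over a nonempty set, which is bounded below as soon as
  \<open>energy_nonneg p b c\<close> holds.\<close>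

definition variational_capacity ::
  "real \<Rightarrow> ('a \<Rightarrow> 'a \<Rightarrow> real) \<Rightarrow> ('a \<Rightarrow> real) \<Rightarrow> 'a \<Rightarrow> real" where
  "variational_capacity p b c x = Inf {energy p b c \<phi> | \<phi>. \<phi> \<in> Cc \<and> \<phi> x = 1}"

text \<open>The set \<open>\<M>(X \<setminus> K)\<close>; the argument is the finite set \<open>K\<close>, not its complement.\<close>

definition minimal_growth ::
  "real \<Rightarrow> ('a \<Rightarrow> real) \<Rightarrow> ('a \<Rightarrow> 'a \<Rightarrow> real) \<Rightarrow> ('a \<Rightarrow> real) \<Rightarrow> 'a set \<Rightarrow> ('a \<Rightarrow> real) set" where
  "minimal_growth p m b c K =
     {u. positive_fun u \<and> harmonic_on p m b c (- K) u \<and>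
         (\<forall>K' v. finite K' \<and> K' \<noteq> {} \<and> connected_in b K' \<and> K \<subseteq> K' \<and>
                 positive_fun v \<and> superharmonic_on p m b c (- K') v \<and>
                 (\<forall>x\<in>K'. u x \<le> v x)
              \<longrightarrow> (\<forall>x\<in>- K'. u x \<le> v x))}"

definition global_minimal_positive_harmonic ::
  "real \<Rightarrow> ('a \<Rightarrow> real) \<Rightarrow> ('a \<Rightarrow> 'a \<Rightarrow> real) \<Rightarrow> ('a \<Rightarrow> real) \<Rightarrow> ('a \<Rightarrow> real) \<Rightarrow> bool" where
  "global_minimal_positive_harmonic p m b c u \<longleftrightarrow> u \<in> minimal_growth p m b c {}"

definition normalised_green ::
  "real \<Rightarrow> ('a \<Rightarrow> real) \<Rightarrow> ('a \<Rightarrow> 'a \<Rightarrow> real) \<Rightarrow> ('a \<Rightarrow> real) \<Rightarrow> 'a \<Rightarrow> ('a \<Rightarrow> real) \<Rightarrow> bool" where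
  "normalised_green p m b c o' u \<longleftrightarrow>
     u \<in> minimal_growth p m b c {o'} \<inter> formal_domain p b UNIV \<and>
     (\<forall>x. schroedinger_op p m b c u x = indicator {o'} x)"

end

theory Submission
  imports Defs
begin

text \<open>
  Everything rests on the elementary touching principle: if \<open>u \<le> v\<close> with equality at \<open>x\<close>, then
  \<open>Hv x \<le> Hu x\<close>, and equality forces \<open>u = v\<close> at all neighbours of \<open>x\<close>. Applied at a maximum of
  \<open>u / v\<close> and propagated along paths it gives a comparison principle on finite sets.

  Along an exhaustion by finite connected sets \<open>K n \<ni> a\<close>, let \<open>g n\<close> minimise the energy among the
  functions supported in \<open>K n\<close> with value \<open>1\<close> at \<open>a\<close>. By comparison and Harnack, \<open>g n\<close> increases
  to a finite \<open>G\<close> of minimal growth off \<open>a\<close> with \<open>m H G = cap(a) 1\<^sub>a\<close>. If \<open>cap(a) > 0\<close>, a multiple of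
  \<open>G\<close> is a normalised Green's function. If \<open>cap(a) = 0\<close>, then \<open>G\<close> is harmonic, and touching a positive
  superharmonic function \<open>v\<close> at \<open>a\<close> from below shows \<open>v = t G\<close>; this rigidity excludes Green's
  functions, makes \<open>G\<close> globally minimal, and makes the capacity vanish at every point at once.
\<close>

subsection \<open>Signed powers and dominated convergence\<close>

lemma spow_nonneg_eq: "a \<ge> 0 \<Longrightarrow> spow a q = a powr q"
  by (cases "a = 0") (auto simp: spow_def)

lemma spow_0 [simp]: "spow 0 q = 0"
  by (simp add: spow_def)

lemma spow_minus: "spow (- a) q = - spow a q"
  by (simp add: spow_def sgn_minus)

lemma abs_spow: "\<bar>spow a q\<bar> = \<bar>a\<bar> powr q"
  by (cases "a = 0") (auto simp: spow_def abs_mult abs_sgn_eq)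

lemma spow_scale: "t > 0 \<Longrightarrow> spow (t * a) q = t powr q * spow a q"
  by (simp add: spow_def abs_mult sgn_mult powr_mult)

lemma mult_spow: "a * spow a (p - 1) = \<bar>a\<bar> powr p"
proof -
  have "a * spow a (p - 1) = (a * sgn a) * \<bar>a\<bar> powr (p - 1)" by (simp add: spow_def)
  also have "\<dots> = \<bar>a\<bar> * \<bar>a\<bar> powr (p - 1)" by (metis abs_sgn)
  also have "\<dots> = \<bar>a\<bar> powr p" using powr_mult_base[of "\<bar>a\<bar>" "p - 1"] by simp
  finally show ?thesis .
qed

lemma spow_strict_mono:
  assumes "q > 0" "a < b" shows "spow a q < spow b q"
proof -
  consider "0 \<le> a" | "a < 0" "0 < b" | "b \<le> 0" using assms by linarith
  then show ?thesis
  proof cases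
    case 1 then show ?thesis using assms by (simp add: spow_nonneg_eq powr_less_mono2)
  next
    case 2
    have "spow (-a) q > 0" "spow b q > 0" using 2 by (simp_all add: spow_nonneg_eq)
    then show ?thesis by (simp add: spow_minus)
  next
    case 3
    have "(-b) powr q < (-a) powr q" using 3 assms by (intro powr_less_mono2) auto
    then have "spow (-b) q < spow (-a) q" using 3 assms by (simp add: spow_nonneg_eq)
    then show ?thesis by (simp add: spow_minus)
  qed
qed

lemma spow_mono: "q > 0 \<Longrightarrow> a \<le> b \<Longrightarrow> spow a q \<le> spow b q"
  using spow_strict_mono[of q a b] by (cases "a = b") auto

lemma spow_inject: "q > 0 \<Longrightarrow> spow a q = spow b q \<longleftrightarrow> a = b"
  by (metis linorder_neqE_linordered_idom order_less_irrefl spow_strict_mono)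

lemma powr_sum_le:
  fixes a b :: real
  assumes "q > 0" "a \<ge> 0" "b \<ge> 0"
  shows "(a + b) powr q \<le> 2 powr q * (a powr q + b powr q)"
proof -
  have "(a + b) powr q \<le> (2 * max a b) powr q" using assms by (intro powr_mono2) auto
  also have "\<dots> = 2 powr q * (max a b) powr q" by (simp add: powr_mult)
  also have "\<dots> \<le> 2 powr q * (a powr q + b powr q)"
    by (intro mult_left_mono) (auto simp: max_def)
  finally show ?thesis .
qed

lemma abs_diff_powr_le:
  fixes a b :: real
  assumes "q > 0"
  shows "\<bar>a - b\<bar> powr q \<le> 2 powr q * (\<bar>a\<bar> powr q + \<bar>b\<bar> powr q)"
proof -
  have "\<bar>a - b\<bar> powr q \<le> (\<bar>a\<bar> + \<bar>b\<bar>) powr q" using assms by (intro powr_mono2) auto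
  also have "\<dots> \<le> 2 powr q * (\<bar>a\<bar> powr q + \<bar>b\<bar> powr q)" using assms by (intro powr_sum_le) auto
  finally show ?thesis .
qed

text \<open>Written with nonnegative bases, the signed power is visibly continuous at 0, and upward
  and downward fluxes can be estimated separately.\<close>

lemma spow_eq_max: "spow a q = (max a 0) powr q - (max (- a) 0) powr q"
  by (cases "a > 0"; cases "a = 0") (auto simp: spow_def max_def)

lemma tendsto_spow:
  assumes "(f \<longlongrightarrow> a) F" "q > 0"
  shows "((\<lambda>n. spow (f n) q) \<longlongrightarrow> spow a q) F"
  unfolding spow_eq_max
  by (intro tendsto_diff tendsto_powr' tendsto_max tendsto_minus tendsto_const assms)
     (use assms in auto)

text \<open>Away from 0 this is the power rule. At 0 the difference quotient is
  \<open>spow h (p - 1)\<close> itself, which tends to 0 because \<open>p > 1\<close>.\<close>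

lemma has_real_derivative_abs_powr:
  fixes a :: real
  assumes "p > 1"
  shows "((\<lambda>s. \<bar>s\<bar> powr p) has_real_derivative p * spow a (p - 1)) (at a)"
proof -
  consider "a > 0" | "a < 0" | "a = 0" by linarith
  then show ?thesis
  proof cases
    case 1
    have "((\<lambda>s. s powr p) has_real_derivative p * a powr (p - 1)) (at a)"
      using 1 by (auto intro!: derivative_eq_intros)
    then have "((\<lambda>s. s powr p) has_real_derivative p * spow a (p - 1)) (at a)"
      using 1 by (simp add: spow_nonneg_eq)
    then show ?thesis
      by (rule has_field_derivative_transform_within[where d = a]) (use 1 in \<open>auto simp: dist_real_def\<close>)
  next
    case 2
    have "((\<lambda>s. (- s) powr p) has_real_derivative - (p * (- a) powr (p - 1))) (at a)"
      using 2 by (auto intro!: derivative_eq_intros)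
    then have "((\<lambda>s. (- s) powr p) has_real_derivative p * spow a (p - 1)) (at a)"
      using 2 spow_minus[of "- a"] by (simp add: spow_nonneg_eq)
    then show ?thesis
      by (rule has_field_derivative_transform_within[where d = "- a"]) (use 2 in \<open>auto simp: dist_real_def\<close>)
  next
    case 3
    have "((\<lambda>h. spow h (p - 1)) \<longlongrightarrow> spow 0 (p - 1)) (at 0)"
      using assms by (intro tendsto_spow) auto
    moreover have "\<bar>h\<bar> powr p / h = spow h (p - 1)" if "h \<noteq> 0" for h
      using mult_spow[of h p] that by (metis nonzero_mult_div_cancel_left)
    then have "\<forall>\<^sub>F h in at 0. spow h (p - 1) = \<bar>h\<bar> powr p / h"
      by (auto simp: eventually_at_filter)
    ultimately show ?thesis using 3 assms
      by (auto simp: DERIV_def cong: filterlim_cong elim: Lim_transform_eventually)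
  qed
qed

section \<open>Dominated convergence for unordered sums\<close>

lemma abs_summable_summable_real:
  fixes f :: "'b \<Rightarrow> real"
  shows "(\<lambda>y. \<bar>f y\<bar>) summable_on S \<Longrightarrow> f summable_on S"
  by (subst summable_on_iff_abs_summable_on_real) simp

text \<open>A finite set \<open>F\<close> carries all but \<open>e / 6\<close> of the sum of
  \<open>M\<close>. On \<open>F\<close> only a finite sum has to converge; off \<open>F\<close> both
  sums are at most \<open>e / 6\<close> in modulus by domination.\<close>

lemma infsum_dominated_convergence:
  fixes f :: "nat \<Rightarrow> 'b \<Rightarrow> real"
  assumes M: "M summable_on UNIV" and dom: "\<And>n y. \<bar>f n y\<bar> \<le> M y"
    and lim: "\<And>y. (\<lambda>n. f n y) \<longlonglongrightarrow> g y"
  shows "(\<lambda>n. infsum (f n) UNIV) \<longlonglongrightarrow> infsum g UNIV"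
proof -
  have gM: "\<bar>g y\<bar> \<le> M y" for y
    by (rule LIMSEQ_le_const2[OF tendsto_rabs[OF lim]]) (use dom in auto)
  have sf: "f n summable_on A" for n A
  proof -
    have "(\<lambda>y. \<bar>f n y\<bar>) summable_on UNIV"
      by (rule summable_on_comparison_test[OF M]) (use dom in auto)
    then have "f n summable_on UNIV" by (rule abs_summable_summable_real)
    then show ?thesis by (rule summable_on_subset_banach) auto
  qed
  have sg: "g summable_on A" for A
  proof -
    have "(\<lambda>y. \<bar>g y\<bar>) summable_on UNIV"
      by (rule summable_on_comparison_test[OF M]) (use gM in auto)
    then have "g summable_on UNIV" by (rule abs_summable_summable_real)
    then show ?thesis by (rule summable_on_subset_banach) auto
  qed
  have sM: "M summable_on A" for A
    by (rule summable_on_subset_banach[OF M]) auto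
  show ?thesis
  proof (rule LIMSEQ_I)
    fix e :: real assume "e > 0"
    then obtain F where F: "finite F" "dist (sum M F) (infsum M UNIV) \<le> e / 6"
      using infsum_finite_approximation[OF M, of "e/6"] by auto
    have split: "infsum h UNIV = sum h F + infsum h (- F)" if "\<And>A. h summable_on A" for h :: "'b \<Rightarrow> real"
      using infsum_Un_disjoint[of h F "- F"] that F by (simp add: Compl_partition)
    have tail: "infsum M (- F) \<le> e / 6" using F split[OF sM] by (simp add: dist_real_def)
    have "(\<lambda>n. sum (f n) F) \<longlonglongrightarrow> sum g F" by (intro tendsto_sum lim)
    then obtain N where N: "\<And>n. n \<ge> N \<Longrightarrow> norm (sum (f n) F - sum g F) < e / 3"
      using LIMSEQ_D[of _ _ "e/3"] \<open>e > 0\<close> by (metis divide_pos_pos zero_less_numeral)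
    have tl: "\<bar>infsum h (- F)\<bar> \<le> e / 6" if "\<And>A. h summable_on A" "\<And>y. \<bar>h y\<bar> \<le> M y" for h :: "'b \<Rightarrow> real"
    proof -
      have h: "h y \<le> M y" "- h y \<le> M y" for y using that(2)[of y] by auto
      have "infsum h (- F) \<le> infsum M (- F)"
        by (intro infsum_mono that(1) sM h)
      moreover have "infsum (\<lambda>y. - h y) (- F) \<le> infsum M (- F)"
        by (intro infsum_mono summable_on_uminus[THEN iffD2] that(1) sM h)
      ultimately show ?thesis using tail by (simp add: infsum_uminus)
    qed
    show "\<exists>N. \<forall>n\<ge>N. norm (infsum (f n) UNIV - infsum g UNIV) < e"
    proof (intro exI allI impI)
      fix n assume "n \<ge> N"
      from N[OF this] tl[OF sf[of n] dom[of n]] tl[OF sg gM] split[OF sf, of n] split[OF sg] \<open>e > 0\<close>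
      show "norm (infsum (f n) UNIV - infsum g UNIV) < e"
        unfolding real_norm_def by linarith
    qed
  qed
qed

subsection \<open>Touching and comparison\<close>

locale nonneg_schroedinger =
  fixes p :: real and m :: "'a \<Rightarrow> real" and b :: "'a \<Rightarrow> 'a \<Rightarrow> real" and c :: "'a \<Rightarrow> real"
  assumes graph: "weighted_graph m b" and p_gt_1: "p > 1" and nonneg: "energy_nonneg p b c"
begin

lemma m_pos: "m x > 0" and b_nonneg: "b x y \<ge> 0" and b_sym: "b x y = b y x"
  and b_summable: "(\<lambda>y. b x y) summable_on UNIV"
  and conn: "connected_in b UNIV" and countable_UNIV: "countable (UNIV :: 'a set)"
  and infinite_UNIV: "infinite (UNIV :: 'a set)"
  using graph unfolding weighted_graph_def by blast+

lemma q_pos: "p - 1 > 0" using p_gt_1 by simp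

text \<open>\<open>A\<close> is \<open>m\<close> times the operator \<open>H\<close>.\<close>

definition A :: "('a \<Rightarrow> real) \<Rightarrow> 'a \<Rightarrow> real" where
  "A f x = (\<Sum>\<^sub>\<infinity>y\<in>UNIV. b x y * spow (f x - f y) (p - 1)) + c x * spow (f x) (p - 1)"

lemma schroedinger_op_eq: "schroedinger_op p m b c f x = A f x / m x"
  by (simp add: schroedinger_op_def A_def add_divide_distrib)

lemma harmonic_on_iff:
  "harmonic_on p m b c V u \<longleftrightarrow> u \<in> formal_domain p b V \<and> (\<forall>x\<in>V. A u x = 0)"
  using m_pos by (simp add: harmonic_on_def schroedinger_op_eq less_imp_neq[symmetric])

lemma superharmonic_on_iff:
  "superharmonic_on p m b c V u \<longleftrightarrow> u \<in> formal_domain p b V \<and> (\<forall>x\<in>V. A u x \<ge> 0)"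
  using m_pos by (simp add: superharmonic_on_def schroedinger_op_eq pos_le_divide_eq)

lemma formal_domain_mono: "V \<subseteq> W \<Longrightarrow> formal_domain p b W \<subseteq> formal_domain p b V"
  by (auto simp: formal_domain_def)

lemma formal_domain_at: "f \<in> formal_domain p b V \<Longrightarrow> x \<in> V \<Longrightarrow> f \<in> formal_domain p b {x}"
  by (auto simp: formal_domain_def)

lemma flux_summable:
  assumes "f \<in> formal_domain p b {x}"
  shows "(\<lambda>y. b x y * spow (s - f y) (p - 1)) summable_on UNIV"
proof -
  have f: "(\<lambda>y. b x y * \<bar>f y\<bar> powr (p - 1)) summable_on UNIV"
    using assms by (simp add: formal_domain_def)
  have "(\<lambda>y. 2 powr (p - 1) * (b x y * \<bar>s\<bar> powr (p - 1) + b x y * \<bar>f y\<bar> powr (p - 1))) summable_on UNIV"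
    by (intro summable_on_cmult_right summable_on_add summable_on_cmult_left b_summable f)
  then have "(\<lambda>y. \<bar>b x y * spow (s - f y) (p - 1)\<bar>) summable_on UNIV"
  proof (rule summable_on_comparison_test)
    fix y
    show "\<bar>b x y * spow (s - f y) (p - 1)\<bar>
      \<le> 2 powr (p - 1) * (b x y * \<bar>s\<bar> powr (p - 1) + b x y * \<bar>f y\<bar> powr (p - 1))"
      using mult_left_mono[OF abs_diff_powr_le[OF q_pos, of s "f y"] b_nonneg[of x y]]
      by (simp add: abs_mult abs_spow b_nonneg algebra_simps)
  qed auto
  then show ?thesis by (rule abs_summable_summable_real)
qed

lemma A_scale:
  assumes "t > 0" shows "A (\<lambda>y. t * f y) x = t powr (p - 1) * A f x"
proof -
  have "b x y * spow (t * f x - t * f y) (p - 1) = t powr (p - 1) * (b x y * spow (f x - f y) (p - 1))" for y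
    using spow_scale[OF assms, of "f x - f y" "p - 1"] by (simp add: right_diff_distrib)
  then have "(\<Sum>\<^sub>\<infinity>y. b x y * spow (t * f x - t * f y) (p - 1))
      = t powr (p - 1) * (\<Sum>\<^sub>\<infinity>y. b x y * spow (f x - f y) (p - 1))"
    by (simp only: infsum_cmult_right')
  then show ?thesis
    using assms by (simp add: A_def spow_scale distrib_left mult.left_commute)
qed

lemma formal_domain_scale:
  assumes "f \<in> formal_domain p b V" shows "(\<lambda>y. t * f y) \<in> formal_domain p b V"
proof -
  have "(\<lambda>y. \<bar>t\<bar> powr (p - 1) * (b x y * \<bar>f y\<bar> powr (p - 1))) summable_on UNIV" if "x \<in> V" for x
    using assms that by (intro summable_on_cmult_right) (auto simp: formal_domain_def)
  then show ?thesis by (simp add: formal_domain_def abs_mult powr_mult algebra_simps)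
qed

lemma zero_formal_domain: "(\<lambda>_. 0) \<in> formal_domain p b V"
  by (simp add: formal_domain_def)

lemma A_zero: "A (\<lambda>_. 0) x = 0"
  by (simp add: A_def)

text \<open>With equal values at \<open>x\<close>, the terms with \<open>c\<close> cancel and each
  flux term of \<open>u\<close> is at least that of \<open>v\<close>. The total excess
  \<open>A u x - A v x\<close> is not positive, so every single excess vanishes, and strict
  monotonicity of \<open>spow\<close> gives equality across each edge.\<close>

lemma touching_neighbour:
  assumes u: "u \<in> formal_domain p b {x}" and v: "v \<in> formal_domain p b {x}"
    and le: "\<And>y. u y \<le> v y" and eq: "u x = v x"
    and A: "A u x \<le> A v x" and nb: "b x y > 0"
  shows "u y = v y"
proof -
  let ?d = "\<lambda>y. b x y * spow (u x - u y) (p - 1) - b x y * spow (v x - v y) (p - 1)"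
  have d0: "?d y \<ge> 0" for y
    using spow_mono[OF q_pos, of "v x - v y" "u x - u y"] le[of y] eq b_nonneg[of x y]
    by (simp add: mult_left_mono)
  have sd: "?d summable_on UNIV"
    using summable_on_add[OF flux_summable[OF u, of "u x"] summable_on_uminus[THEN iffD2, OF flux_summable[OF v, of "v x"]]]
    by simp
  have d: "infsum ?d UNIV = A u x - A v x"
    using infsum_add[OF flux_summable[OF u, of "u x"] summable_on_uminus[THEN iffD2, OF flux_summable[OF v, of "v x"]]]
    by (simp add: A_def eq infsum_uminus)
  have "?d y = 0" using nonneg_infsum_le_0D[of ?d UNIV y] sd d0 d A by simp
  then show "u y = v y" using nb eq spow_inject[OF q_pos] by simp
qed

text \<open>Induction along a path. This turns a statement about touching at one vertex into one
  about a whole connected set.\<close>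

lemma closed_under_neighbours_connected:
  assumes "connected_in b S" "x \<in> S" "x \<in> T"
    and step: "\<And>s t. s \<in> S \<Longrightarrow> s \<in> T \<Longrightarrow> t \<in> S \<Longrightarrow> b s t > 0 \<Longrightarrow> t \<in> T"
  shows "S \<subseteq> T"
proof
  fix y assume "y \<in> S"
  then have "(\<lambda>s t. s \<in> S \<and> t \<in> S \<and> b s t > 0)\<^sup>*\<^sup>* x y"
    using assms(1,2) by (simp add: connected_in_def)
  then show "y \<in> T" by induction (use assms in auto)
qed

text \<open>Strong minimum principle: at a zero of \<open>v\<close> the zero function touches
  \<open>v\<close> from below, so zeros spread to all neighbours. On \<open>K\<close> no inequality
  for \<open>A v\<close> is available, but zeros never reach it.\<close>

lemma superharmonic_positive:
  assumes v: "\<And>y. v y \<ge> 0" and dom: "v \<in> formal_domain p b (- K)"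
    and super: "\<And>x. x \<in> - K \<Longrightarrow> A v x \<ge> 0"
    and K: "\<And>x. x \<in> K \<Longrightarrow> v x > 0" and nz: "v z \<noteq> 0"
  shows "v x > 0"
proof (rule ccontr)
  assume "\<not> v x > 0"
  then have x: "v x = 0" using v[of x] by simp
  have "UNIV \<subseteq> {y. v y = 0}"
  proof (rule closed_under_neighbours_connected[OF conn, of x])
    fix s t assume st: "s \<in> {y. v y = 0}" "b s t > 0"
    then have s: "s \<in> - K" using K by force
    have "0 = v t"
      using touching_neighbour[OF zero_formal_domain formal_domain_at[OF dom s], of t] v st super[OF s]
      by (simp add: A_zero)
    then show "t \<in> {y. v y = 0}" by simp
  qed (use x in auto)
  then show False using nz by auto
qed

text \<open>If \<open>u\<close> exceeded \<open>v\<close>, the largest ratio \<open>t\<close> of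
  \<open>u\<close> to \<open>v\<close> on \<open>W\<close> would be greater than 1. By homogeneity
  \<open>t * v\<close> is still superharmonic on \<open>W\<close>, and it touches \<open>u\<close>
  at a maximiser. The touching set then spreads over all of \<open>{x. v x > 0}\<close> while
  staying inside \<open>W\<close>, which the point \<open>z\<close> contradicts. Connectedness is
  asked of the positivity set so that both finitely supported and everywhere positive
  \<open>v\<close> are covered.\<close>

lemma comparison:
  assumes fin: "finite W" and W: "\<And>x. x \<in> W \<Longrightarrow> v x > 0" and v: "\<And>x. v x \<ge> 0"
    and conn: "connected_in b {x. v x > 0}" and z: "v z > 0" "z \<notin> W"
    and off: "\<And>x. x \<notin> W \<Longrightarrow> u x \<le> v x"
    and du: "u \<in> formal_domain p b W" and dv: "v \<in> formal_domain p b W"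
    and Au: "\<And>x. x \<in> W \<Longrightarrow> A u x \<le> 0" and Av: "\<And>x. x \<in> W \<Longrightarrow> A v x \<ge> 0"
  shows "u x \<le> v x"
proof (rule ccontr)
  assume "\<not> u x \<le> v x"
  then have x: "x \<in> W" "u x > v x" using off by force+
  define t where "t = Max ((\<lambda>x. u x / v x) ` W)"
  have t_ge: "u y / v y \<le> t" if "y \<in> W" for y
    unfolding t_def using fin that by (intro Max_ge) auto
  have t1: "t > 1"
    using t_ge[OF x(1)] x(2) W[OF x(1)] by (smt (verit) less_divide_eq_1_pos)
  obtain a where a: "a \<in> W" "u a / v a = t"
    using Max_in[of "(\<lambda>x. u x / v x) ` W"] fin x(1) unfolding t_def by fastforce
  have le: "u y \<le> t * v y" for y
  proof (cases "y \<in> W")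
    case True then show ?thesis using t_ge[OF True] W[OF True] by (simp add: divide_le_eq)
  next
    case False
    have "v y \<le> t * v y" using t1 v[of y] by (simp add: mult_le_cancel_right1)
    then show ?thesis using off[OF False] by linarith
  qed
  let ?T = "{y \<in> W. u y = t * v y}"
  have "{x. v x > 0} \<subseteq> ?T"
  proof (rule closed_under_neighbours_connected[OF conn, of a])
    show "a \<in> ?T" "a \<in> {x. v x > 0}" using a W[OF a(1)] by auto
  next
    fix r s assume r: "r \<in> ?T" and s: "s \<in> {x. v x > 0}" and rs: "b r s > 0"
    then have rW: "r \<in> W" by auto
    have "A u r \<le> A (\<lambda>y. t * v y) r"
    proof -
      have "0 \<le> t powr (p - 1) * A v r" using Av[OF rW] by simp
      then show ?thesis using Au[OF rW] t1 by (simp add: A_scale)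
    qed
    then have eq: "u s = t * v s"
      using touching_neighbour[OF formal_domain_at[OF du rW] formal_domain_scale[OF formal_domain_at[OF dv rW], of t]]
        le r rs by simp
    \<comment> \<open>Off \<open>W\<close> one has \<open>u s \<le> v s\<close>, strictly below
      \<open>t * v s\<close>, so the touching set cannot leave \<open>W\<close>.\<close>
    have "v s < t * v s" using t1 s by simp
    then have "s \<in> W" using off[of s] eq by force
    then show "s \<in> ?T" using eq by simp
  qed
  then show False using z by auto
qed

subsection \<open>Energy minimisers on finite sets\<close>

text \<open>For functions vanishing off \<open>K\<close>, the edges leaving \<open>K\<close> act as
  an additional potential of this size.\<close>

definition boundary_weight :: "'a set \<Rightarrow> 'a \<Rightarrow> real" where
  "boundary_weight K x = (\<Sum>\<^sub>\<infinity>y\<in>- K. b x y)"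

text \<open>Stands for \<open>energy\<close> on functions vanishing off \<open>K\<close>. Being a
  finite sum in the values on \<open>K\<close>, it can be differentiated term by term and is
  continuous for the product topology.\<close>

definition fin_energy :: "'a set \<Rightarrow> ('a \<Rightarrow> real) \<Rightarrow> real" where
  "fin_energy K \<phi> = 1 / 2 * (\<Sum>x\<in>K. \<Sum>y\<in>K. b x y * \<bar>\<phi> x - \<phi> y\<bar> powr p)
     + (\<Sum>x\<in>K. (c x + boundary_weight K x) * \<bar>\<phi> x\<bar> powr p)"

lemma has_sum_boundary_weight:
  assumes "\<And>y. y \<notin> K \<Longrightarrow> g y = a"
  shows "((\<lambda>y. b x y * g y) has_sum boundary_weight K x * a) (- K)"
proof -
  have "(b x has_sum boundary_weight K x) (- K)"
    unfolding boundary_weight_def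
    by (rule has_sum_infsum) (rule summable_on_subset_banach[OF b_summable], auto)
  then have "((\<lambda>y. b x y * a) has_sum boundary_weight K x * a) (- K)" by (rule has_sum_cmult_left)
  then show ?thesis by (rule has_sum_cong[THEN iffD1, rotated]) (use assms in auto)
qed

lemma has_sum_b_split:
  assumes "finite K" "\<And>y. y \<notin> K \<Longrightarrow> g y = a"
  shows "((\<lambda>y. b x y * g y) has_sum (\<Sum>y\<in>K. b x y * g y) + boundary_weight K x * a) UNIV"
proof -
  have "((\<lambda>y. b x y * g y) has_sum (\<Sum>y\<in>K. b x y * g y) + boundary_weight K x * a) (K \<union> - K)"
    by (rule has_sum_Un_disjoint[OF has_sum_finite[OF assms(1)] has_sum_boundary_weight[OF assms(2)]]) auto
  then show ?thesis by simp
qed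

lemma finite_support_formal_domain:
  assumes "finite K" "\<And>y. y \<notin> K \<Longrightarrow> \<phi> y = 0"
  shows "\<phi> \<in> formal_domain p b V"
  unfolding formal_domain_def
  using has_sum_b_split[OF assms(1), of "\<lambda>y. \<bar>\<phi> y\<bar> powr (p - 1)" 0] assms(2)
  by (auto simp: summable_on_def)

lemma A_finite_support:
  assumes "finite K" "\<And>y. y \<notin> K \<Longrightarrow> \<phi> y = 0"
  shows "A \<phi> x = (\<Sum>y\<in>K. b x y * spow (\<phi> x - \<phi> y) (p - 1)) + (c x + boundary_weight K x) * spow (\<phi> x) (p - 1)"
  using infsumI[OF has_sum_b_split[OF assms(1), of "\<lambda>y. spow (\<phi> x - \<phi> y) (p - 1)" "spow (\<phi> x) (p - 1)" x]]
    assms(2)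
  by (simp add: A_def distrib_right)

text \<open>Only pairs meeting \<open>K\<close> contribute. The pairs with exactly one point in
  \<open>K\<close> occur in both orders, which cancels the factor one half in front of the boundary
  term.\<close>

lemma energy_finite_support:
  assumes fin: "finite K" and supp: "\<And>y. y \<notin> K \<Longrightarrow> \<phi> y = 0"
  shows "energy p b c \<phi> = fin_energy K \<phi>"
proof -
  define f where "f = (\<lambda>(x, y). b x y * \<bar>\<phi> x - \<phi> y\<bar> powr p)"
  define g where "g x = (\<Sum>y\<in>K. b x y * \<bar>\<phi> x - \<phi> y\<bar> powr p) + boundary_weight K x * \<bar>\<phi> x\<bar> powr p" for x
  have "(f has_sum g x) (Pair x ` UNIV)" for x
    using has_sum_b_split[OF fin, of "\<lambda>y. \<bar>\<phi> x - \<phi> y\<bar> powr p" "\<bar>\<phi> x\<bar> powr p" x] supp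
    by (subst has_sum_reindex) (auto simp: inj_on_def f_def g_def o_def)
  then have "(f has_sum sum g K) (\<Union>x\<in>K. Pair x ` UNIV)"
    by (intro sum_has_sum fin) auto
  \<comment> \<open>These are the columns over \<open>y \<in> K\<close> with first coordinate
    outside \<open>K\<close>; symmetry of \<open>b\<close> gives them the same boundary weight as
    the rows.\<close>
  moreover have "(f has_sum boundary_weight K y * \<bar>\<phi> y\<bar> powr p) ((\<lambda>x. (x, y)) ` (- K))" for y
    using has_sum_boundary_weight[of K "\<lambda>x. \<bar>\<phi> x - \<phi> y\<bar> powr p" "\<bar>\<phi> y\<bar> powr p" y] supp
    by (subst has_sum_reindex) (auto simp: inj_on_def f_def o_def b_sym[of _ y])
  then have "(f has_sum (\<Sum>y\<in>K. boundary_weight K y * \<bar>\<phi> y\<bar> powr p)) (\<Union>y\<in>K. (\<lambda>x. (x, y)) ` (- K))"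
    by (intro sum_has_sum fin) auto
  ultimately have "(f has_sum sum g K + (\<Sum>y\<in>K. boundary_weight K y * \<bar>\<phi> y\<bar> powr p))
      ((\<Union>x\<in>K. Pair x ` UNIV) \<union> (\<Union>y\<in>K. (\<lambda>x. (x, y)) ` (- K)))"
    by (rule has_sum_Un_disjoint) auto
  moreover have "(\<Union>x\<in>K. Pair x ` UNIV) \<union> (\<Union>y\<in>K. (\<lambda>x. (x, y)) ` (- K)) = {(x, y). x \<in> K \<or> y \<in> K}"
    by auto
  ultimately have "(f has_sum sum g K + (\<Sum>y\<in>K. boundary_weight K y * \<bar>\<phi> y\<bar> powr p)) {(x, y). x \<in> K \<or> y \<in> K}"
    by simp
  moreover have "f z = 0" if "z \<notin> {(x, y). x \<in> K \<or> y \<in> K}" for z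
    using that supp by (cases z) (simp add: f_def)
  ultimately have "(f has_sum sum g K + (\<Sum>y\<in>K. boundary_weight K y * \<bar>\<phi> y\<bar> powr p)) UNIV"
    by (subst has_sum_cong_neutral[where T = "{(x, y). x \<in> K \<or> y \<in> K}" and g = f]) blast+
  then have 1: "infsum f UNIV = sum g K + (\<Sum>y\<in>K. boundary_weight K y * \<bar>\<phi> y\<bar> powr p)"
    by (rule infsumI)
  have 2: "(\<Sum>\<^sub>\<infinity>x. c x * \<bar>\<phi> x\<bar> powr p) = (\<Sum>x\<in>K. c x * \<bar>\<phi> x\<bar> powr p)"
    by (subst infsum_finite[OF fin, symmetric], rule infsum_cong_neutral) (use supp in auto)
  show ?thesis
    unfolding energy_def fin_energy_def f_def[symmetric] 1 2
    by (simp add: g_def sum.distrib distrib_right)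
qed

lemma energy_nonneg_support:
  assumes "finite K" "\<And>y. y \<notin> K \<Longrightarrow> \<phi> y = 0"
  shows "energy p b c \<phi> \<ge> 0"
proof -
  have "{x. \<phi> x \<noteq> 0} \<subseteq> K" using assms(2) by auto
  then have "\<phi> \<in> Cc" using assms(1) finite_subset by (auto simp: Cc_def)
  then show ?thesis using nonneg by (simp add: energy_nonneg_def)
qed

section \<open>Homogeneity, summation by parts and the first variation\<close>

lemma fin_energy_scale: "fin_energy K (\<lambda>x. t * \<phi> x) = \<bar>t\<bar> powr p * fin_energy K \<phi>"
proof -
  have "\<bar>t * \<phi> x - t * \<phi> y\<bar> powr p = \<bar>t\<bar> powr p * \<bar>\<phi> x - \<phi> y\<bar> powr p" for x y
    by (simp add: right_diff_distrib[symmetric] abs_mult powr_mult)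
  then show ?thesis
    by (simp add: fin_energy_def abs_mult powr_mult sum_distrib_left distrib_left mult.left_commute)
qed

lemma fin_energy_abs_le: "fin_energy K (\<lambda>x. \<bar>\<phi> x\<bar>) \<le> fin_energy K \<phi>"
proof -
  have "b x y * \<bar>\<bar>\<phi> x\<bar> - \<bar>\<phi> y\<bar>\<bar> powr p \<le> b x y * \<bar>\<phi> x - \<phi> y\<bar> powr p" for x y
    using p_gt_1 by (intro mult_left_mono powr_mono2 b_nonneg) auto
  then show ?thesis by (auto simp: fin_energy_def intro!: sum_mono)
qed

text \<open>The flux is antisymmetric in \<open>x\<close> and \<open>y\<close>, so exchanging the
  summation variables shows that the part with \<open>\<psi> y\<close> doubles the part with
  \<open>\<psi> x\<close>. The boundary weight accounts for the rest of the sum in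
  \<open>A \<phi> x\<close>.\<close>

lemma green_formula:
  assumes "finite K" "\<And>y. y \<notin> K \<Longrightarrow> \<phi> y = 0"
  shows "1 / 2 * (\<Sum>x\<in>K. \<Sum>y\<in>K. b x y * (spow (\<phi> x - \<phi> y) (p - 1) * (\<psi> x - \<psi> y)))
     + (\<Sum>x\<in>K. (c x + boundary_weight K x) * (spow (\<phi> x) (p - 1) * \<psi> x)) = (\<Sum>x\<in>K. \<psi> x * A \<phi> x)"
proof -
  let ?s = "\<lambda>x y. b x y * spow (\<phi> x - \<phi> y) (p - 1)"
  have anti: "?s x y = - ?s y x" for x y
    using spow_minus[of "\<phi> y - \<phi> x"] by (simp add: b_sym[of x y])
  have "(\<Sum>x\<in>K. \<Sum>y\<in>K. ?s x y * \<psi> y) = (\<Sum>x\<in>K. \<Sum>y\<in>K. ?s y x * \<psi> x)"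
    by (rule sum.swap)
  also have "\<dots> = - (\<Sum>x\<in>K. \<Sum>y\<in>K. ?s x y * \<psi> x)"
    by (subst anti) (simp add: sum_negf)
  finally have "(\<Sum>x\<in>K. \<Sum>y\<in>K. b x y * (spow (\<phi> x - \<phi> y) (p - 1) * (\<psi> x - \<psi> y)))
      = 2 * (\<Sum>x\<in>K. \<Sum>y\<in>K. ?s x y * \<psi> x)"
    by (simp add: right_diff_distrib sum_subtractf mult.assoc)
  then show ?thesis
    by (simp add: A_finite_support[where \<phi> = \<phi>, OF assms] distrib_left sum.distrib sum_distrib_left mult.commute mult.left_commute)
qed

text \<open>Euler's identity for a homogeneous functional: Green's formula tested with
  \<open>\<phi>\<close> itself.\<close>

lemma euler:
  assumes "finite K" "\<And>y. y \<notin> K \<Longrightarrow> \<phi> y = 0"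
  shows "fin_energy K \<phi> = (\<Sum>x\<in>K. \<phi> x * A \<phi> x)"
  using green_formula[where \<phi> = \<phi> and \<psi> = \<phi>, OF assms]
  by (simp add: fin_energy_def mult_spow[of _ p] mult.commute[of "spow _ _"])

lemma fin_energy_derivative:
  assumes "finite K" "\<And>y. y \<notin> K \<Longrightarrow> \<phi> y = 0"
  shows "((\<lambda>s. fin_energy K (\<lambda>x. \<phi> x + s * \<psi> x)) has_real_derivative p * (\<Sum>x\<in>K. \<psi> x * A \<phi> x)) (at 0)"
proof -
  have d: "((\<lambda>s. \<bar>a + s * e\<bar> powr p) has_real_derivative p * (spow a (p - 1) * e)) (at 0)" for a e
  proof -
    have "((\<lambda>s. a + s * e) has_real_derivative e) (at 0)" by (auto intro!: derivative_eq_intros)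
    then show ?thesis
      using DERIV_chain2[of "\<lambda>s. \<bar>s\<bar> powr p" "p * spow a (p - 1)" "\<lambda>s. a + s * e" 0 e UNIV]
        has_real_derivative_abs_powr[OF p_gt_1, of a]
      by (simp add: mult.assoc)
  qed
  have "((\<lambda>s. b x y * \<bar>(\<phi> x + s * \<psi> x) - (\<phi> y + s * \<psi> y)\<bar> powr p) has_real_derivative
      p * (b x y * (spow (\<phi> x - \<phi> y) (p - 1) * (\<psi> x - \<psi> y)))) (at 0)" for x y
    using DERIV_cmult[OF d[of "\<phi> x - \<phi> y" "\<psi> x - \<psi> y"], of "b x y"]
    by (simp add: algebra_simps)
  moreover have "((\<lambda>s. (c x + boundary_weight K x) * \<bar>\<phi> x + s * \<psi> x\<bar> powr p) has_real_derivative
      p * ((c x + boundary_weight K x) * (spow (\<phi> x) (p - 1) * \<psi> x))) (at 0)" for x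
    using DERIV_cmult[OF d[of "\<phi> x" "\<psi> x"], of "c x + boundary_weight K x"]
    by (simp add: mult.left_commute)
  ultimately have "((\<lambda>s. fin_energy K (\<lambda>x. \<phi> x + s * \<psi> x)) has_real_derivative
      1 / 2 * (\<Sum>x\<in>K. \<Sum>y\<in>K. p * (b x y * (spow (\<phi> x - \<phi> y) (p - 1) * (\<psi> x - \<psi> y))))
     + (\<Sum>x\<in>K. p * ((c x + boundary_weight K x) * (spow (\<phi> x) (p - 1) * \<psi> x)))) (at 0)"
    unfolding fin_energy_def
    by (intro DERIV_add DERIV_cmult DERIV_sum)
  moreover have "(\<Sum>x\<in>K. \<psi> x * A \<phi> x)
      = 1 / 2 * (\<Sum>x\<in>K. \<Sum>y\<in>K. b x y * (spow (\<phi> x - \<phi> y) (p - 1) * (\<psi> x - \<psi> y)))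
      + (\<Sum>x\<in>K. (c x + boundary_weight K x) * (spow (\<phi> x) (p - 1) * \<psi> x))"
    by (rule green_formula[symmetric]) (use assms in auto)
  ultimately show ?thesis
    by (simp add: sum_distrib_left[symmetric] distrib_left)
qed

text \<open>Varying the value at \<open>x\<close> alone singles out the term
  \<open>A \<phi> x\<close> of the first variation.\<close>

lemma critical_point:
  assumes "finite K" "\<And>y. y \<notin> K \<Longrightarrow> \<phi> y = 0" and x: "x \<in> K"
    and min: "\<And>s. fin_energy K \<phi> \<le> fin_energy K (\<lambda>y. \<phi> y + s * indicator {x} y)"
  shows "A \<phi> x = 0"
proof -
  have "p * (\<Sum>y\<in>K. indicator {x} y * A \<phi> y) = 0"
    by (rule DERIV_local_min[OF fin_energy_derivative[where \<phi> = \<phi>, OF assms(1,2)], of 1]) (use min in auto)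
  moreover have "(\<Sum>y\<in>K. indicator {x} y * A \<phi> y) = (\<Sum>y\<in>K. if y = x then A \<phi> x else 0)"
    by (rule sum.cong) auto
  ultimately show ?thesis
    using p_gt_1 assms(1) x by simp
qed

text \<open>A finitely supported function of zero energy would minimise the energy globally, so its absolute
  value would be harmonic and hence positive on the infinite set \<open>X\<close>.\<close>

lemma fin_energy_pos:
  assumes fin: "finite K" and supp: "\<And>y. y \<notin> K \<Longrightarrow> \<phi> y = 0" and nz: "\<phi> z \<noteq> 0"
  shows "fin_energy K \<phi> > 0"
proof (rule ccontr)
  assume neg: "\<not> fin_energy K \<phi> > 0"
  define \<psi> where "\<psi> x = \<bar>\<phi> x\<bar>" for x
  have supp': "\<psi> y = 0" if "y \<notin> K" for y using supp[OF that] by (simp add: \<psi>_def)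
  have "energy p b c \<psi> \<le> 0"
    using fin_energy_abs_le[of K \<phi>] neg energy_finite_support[of K \<psi>, OF fin supp']
    by (simp add: \<psi>_def[abs_def])
  \<comment> \<open>Enlarging the support set by \<open>x\<close> allows variations at every vertex
    of the graph, including those outside \<open>K\<close>.\<close>
  moreover have "energy p b c \<psi> = fin_energy (insert x K) \<psi>" for x
    by (rule energy_finite_support) (use fin supp' in auto)
  moreover have "0 \<le> fin_energy (insert x K) (\<lambda>y. \<psi> y + s * indicator {x} y)" for s x
  proof -
    have "\<psi> y + s * indicator {x} y = 0" if "y \<notin> insert x K" for y using that supp' by auto
    then show ?thesis
      using energy_nonneg_support[of "insert x K"] energy_finite_support[of "insert x K"] fin
      by (metis (no_types, lifting) finite_insert)
  qed
  ultimately have "fin_energy (insert x K) \<psi> \<le> fin_energy (insert x K) (\<lambda>y. \<psi> y + s * indicator {x} y)" for s x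
    by (metis order_trans)
  then have "A \<psi> x = 0" for x
    by (intro critical_point[of "insert x K"]) (use fin supp' in auto)
  then have pos: "\<psi> x > 0" for x
    using superharmonic_positive[of \<psi> "{}" z x] finite_support_formal_domain[where \<phi> = \<psi>, OF fin supp'] nz
    by (simp add: \<psi>_def)
  have "x \<in> K" for x using supp'[of x] pos[of x] by auto
  then have "UNIV \<subseteq> K" by blast
  then show False using fin infinite_UNIV finite_subset by blast
qed

section \<open>Existence of minimisers by compactness\<close>

definition cube :: "'a set \<Rightarrow> real \<Rightarrow> ('a \<Rightarrow> real) set" where
  "cube K R = {\<phi>. (\<forall>x\<in>K. \<bar>\<phi> x\<bar> \<le> R) \<and> (\<forall>x. x \<notin> K \<longrightarrow> \<phi> x = 0)}"

text \<open>Inside the product space of all functions the cube is a product of intervals and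
  singletons, so Tychonoff applies.\<close>

lemma compact_cube: "compact (cube K R)"
proof -
  have "cube K R = PiE UNIV (\<lambda>x. if x \<in> K then {-R..R} else {0})"
    by (auto simp: cube_def PiE_def Pi_def abs_le_iff split: if_splits)
  moreover have "compactin (product_topology (\<lambda>_. euclidean) UNIV) (PiE UNIV (\<lambda>x. if x \<in> K then {-R..R} else {0::real}))"
    by (subst compactin_PiE) (auto split: if_splits)
  ultimately show ?thesis by (simp add: euclidean_product_topology)
qed

lemma continuous_coordinate: "continuous_on S (\<lambda>\<phi>::'a \<Rightarrow> real. \<phi> x)"
  by (rule continuous_on_subset[OF continuous_on_product_coordinates]) auto

lemma continuous_fin_energy: "continuous_on S (fin_energy K)"
  unfolding fin_energy_def[abs_def]
  by (intro continuous_on_add continuous_on_mult continuous_on_sum continuous_on_const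
      continuous_on_powr' continuous_on_rabs continuous_on_diff continuous_coordinate)
    (use p_gt_1 in auto)

text \<open>The constant is the minimum of the energy on the unit sphere of the supremum norm,
  positive by \<open>fin_energy_pos\<close>; homogeneity extends the bound to all functions
  supported in \<open>K\<close>.\<close>

lemma coercive:
  assumes fin: "finite K" and "z \<in> K"
  obtains l where "l > 0"
    "\<And>(\<phi>::'a \<Rightarrow> real) x. (\<And>y. y \<notin> K \<Longrightarrow> \<phi> y = 0) \<Longrightarrow> x \<in> K \<Longrightarrow> l * \<bar>\<phi> x\<bar> powr p \<le> fin_energy K \<phi>"
proof -
  \<comment> \<open>The unit sphere as a finite union of compact faces, one for each vertex where
    the norm is attained.\<close>
  define S where "S = (\<Union>x\<in>K. cube K 1 \<inter> {\<phi>. \<bar>\<phi> x\<bar> = 1})"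
  have "closed {\<phi>::'a \<Rightarrow> real. \<bar>\<phi> x\<bar> = 1}" for x
    by (intro closed_Collect_eq continuous_on_rabs continuous_coordinate continuous_on_const)
  then have "compact S"
    unfolding S_def by (intro compact_UN fin compact_Int_closed compact_cube)
  moreover have "indicator {z} \<in> S"
    using \<open>z \<in> K\<close> by (auto simp: S_def cube_def indicator_def)
  ultimately obtain \<phi>0 where \<phi>0: "\<phi>0 \<in> S" "\<And>\<psi>. \<psi> \<in> S \<Longrightarrow> fin_energy K \<phi>0 \<le> fin_energy K \<psi>"
    using continuous_attains_inf[OF _ _ continuous_fin_energy, of S K] by blast
  have pos: "fin_energy K \<phi>0 > 0"
  proof -
    obtain x where "x \<in> K" "\<bar>\<phi>0 x\<bar> = 1" "\<phi>0 \<in> cube K 1" using \<phi>0(1) by (auto simp: S_def)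
    then show ?thesis by (intro fin_energy_pos[of K \<phi>0 x] fin) (auto simp: cube_def)
  qed
  show thesis
  proof (rule that[OF pos])
    fix \<phi> :: "'a \<Rightarrow> real" and x assume supp: "\<And>y. y \<notin> K \<Longrightarrow> \<phi> y = 0" and x: "x \<in> K"
    define M where "M = Max ((\<lambda>y. \<bar>\<phi> y\<bar>) ` K)"
    have le: "\<bar>\<phi> y\<bar> \<le> M" if "y \<in> K" for y using fin that by (auto simp: M_def)
    have "M \<in> (\<lambda>y. \<bar>\<phi> y\<bar>) ` K" unfolding M_def by (rule Max_in) (use fin x in auto)
    then obtain w where w: "w \<in> K" "\<bar>\<phi> w\<bar> = M" by auto
    show "fin_energy K \<phi>0 * \<bar>\<phi> x\<bar> powr p \<le> fin_energy K \<phi>"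
    proof (cases "M = 0")
      case True
      then have "\<phi> = (\<lambda>_. 0)" using le supp by (metis abs_le_zero_iff)
      then show ?thesis by (simp add: fin_energy_def)
    next
      case False
      then have M: "M > 0" using w by auto
      have "(\<lambda>y. inverse M * \<phi> y) \<in> S"
        using w M supp le unfolding S_def cube_def
        by (auto simp: abs_mult intro!: bexI[of _ w]) (simp_all add: field_simps)
      then have "fin_energy K \<phi>0 \<le> fin_energy K (\<lambda>y. inverse M * \<phi> y)" by (rule \<phi>0)
      also have "\<dots> = inverse (M powr p) * fin_energy K \<phi>"
        using M by (simp only: fin_energy_scale) (simp add: inverse_powr)
      finally have "fin_energy K \<phi>0 * M powr p \<le> fin_energy K \<phi>" using M by (simp add: field_simps)
      moreover have "\<bar>\<phi> x\<bar> powr p \<le> M powr p" using le[OF x] p_gt_1 by (intro powr_mono2) auto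
      ultimately show ?thesis using pos by (meson mult_left_mono order_trans less_imp_le)
    qed
  qed
qed

text \<open>Direct method: a competitor outside a large cube costs at least as much as
  \<open>indicator {a}\<close>, so minimising over the compact slice inside the cube suffices.
  Taking absolute values does not raise the energy.\<close>

lemma minimiser:
  assumes fin: "finite K" and a: "a \<in> K"
  obtains \<phi> where "\<phi> a = 1" "\<And>x. \<phi> x \<ge> 0" "\<And>x. x \<notin> K \<Longrightarrow> \<phi> x = 0"
    "\<And>\<psi>. \<psi> a = 1 \<Longrightarrow> (\<And>x. x \<notin> K \<Longrightarrow> \<psi> x = 0) \<Longrightarrow> fin_energy K \<phi> \<le> fin_energy K \<psi>"
proof -
  obtain l where l: "l > 0"
    "\<And>(\<phi>::'a \<Rightarrow> real) x. (\<And>y. y \<notin> K \<Longrightarrow> \<phi> y = 0) \<Longrightarrow> x \<in> K \<Longrightarrow> l * \<bar>\<phi> x\<bar> powr p \<le> fin_energy K \<phi>"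
    using coercive[OF assms] by blast
  let ?d = "indicator {a} :: 'a \<Rightarrow> real"
  define e where "e = fin_energy K ?d"
  have d_supp: "?d y = 0" if "y \<notin> K" for y using that a by (auto simp: indicator_def)
  \<comment> \<open>The second entry makes \<open>l * R powr p\<close> at least \<open>e\<close>;
    the entry 1 keeps the indicator inside the cube.\<close>
  define R where "R = max 1 ((e / l) powr (1 / p))"
  have e: "1 \<le> e / l" using l(2)[of ?d a] d_supp a l(1) by (simp add: e_def)
  have "e > 0" using e l(1) by (simp add: le_divide_eq)
  then have "e / l = ((e / l) powr (1 / p)) powr p" using e l(1) p_gt_1 by (simp add: powr_powr)
  also have "\<dots> \<le> R powr p" using p_gt_1 by (intro powr_mono2) (auto simp: R_def)
  finally have R: "e \<le> l * R powr p" using l(1) by (simp add: divide_le_eq mult.commute)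
  define S where "S = cube K R \<inter> {\<phi>. \<phi> a = 1}"
  have "closed {\<phi>::'a \<Rightarrow> real. \<phi> a = 1}"
    by (intro closed_Collect_eq continuous_coordinate continuous_on_const)
  then have "compact S" unfolding S_def by (intro compact_Int_closed compact_cube)
  moreover have dS: "?d \<in> S"
    using a by (auto simp: S_def cube_def R_def indicator_def)
  ultimately obtain \<phi> where \<phi>: "\<phi> \<in> S" "\<And>\<psi>. \<psi> \<in> S \<Longrightarrow> fin_energy K \<phi> \<le> fin_energy K \<psi>"
    using continuous_attains_inf[OF _ _ continuous_fin_energy, of S K] by blast
  show thesis
  proof (rule that[of "\<lambda>x. \<bar>\<phi> x\<bar>"])
    fix \<psi> assume \<psi>: "\<psi> a = 1" "\<And>x. x \<notin> K \<Longrightarrow> \<psi> x = (0::real)"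
    have "fin_energy K \<phi> \<le> fin_energy K \<psi>"
    proof (cases "\<psi> \<in> S")
      case True then show ?thesis by (rule \<phi>)
    next
      case False
      then obtain x where x: "x \<in> K" "\<bar>\<psi> x\<bar> > R" using \<psi> by (auto simp: S_def cube_def not_le)
      have "fin_energy K \<phi> \<le> e" unfolding e_def by (rule \<phi>(2)[OF dS])
      also have "\<dots> \<le> l * \<bar>\<psi> x\<bar> powr p"
      proof -
        have "R powr p \<le> \<bar>\<psi> x\<bar> powr p" using x p_gt_1 by (intro powr_mono2) (auto simp: R_def)
        then show ?thesis using R mult_left_mono[of "R powr p" "\<bar>\<psi> x\<bar> powr p" l] l(1) by linarith
      qed
      also have "\<dots> \<le> fin_energy K \<psi>" by (rule l(2)[OF \<psi>(2) x(1)])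
      finally show ?thesis .
    qed
    then show "fin_energy K (\<lambda>x. \<bar>\<phi> x\<bar>) \<le> fin_energy K \<psi>"
      using fin_energy_abs_le[of K \<phi>] by linarith
  qed (use \<phi>(1) in \<open>auto simp: S_def cube_def\<close>)
qed

text \<open>Away from \<open>a\<close> the minimiser is free to vary, so \<open>A\<close> vanishes
  there. A zero in \<open>K\<close> is therefore a point where the zero function touches from below,
  and zeros would spread through the connected set \<open>K\<close> to \<open>a\<close>. In Euler's
  identity only the term at \<open>a\<close> survives.\<close>

lemma equilibrium:
  assumes fin: "finite K" and a: "a \<in> K" and con: "connected_in b K"
  obtains \<phi> where "\<phi> a = 1" "\<And>x. x \<in> K \<Longrightarrow> \<phi> x > 0" "\<And>x. x \<notin> K \<Longrightarrow> \<phi> x = 0"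
    "\<And>x. x \<in> K \<Longrightarrow> x \<noteq> a \<Longrightarrow> A \<phi> x = 0" "A \<phi> a = energy p b c \<phi>"
    "\<And>\<psi>. \<psi> a = 1 \<Longrightarrow> (\<And>x. x \<notin> K \<Longrightarrow> \<psi> x = 0) \<Longrightarrow> energy p b c \<phi> \<le> energy p b c \<psi>"
proof -
  obtain \<phi> where \<phi>: "\<phi> a = 1" "\<And>x. \<phi> x \<ge> 0" and supp: "\<And>x. x \<notin> K \<Longrightarrow> \<phi> x = 0" and
    min: "\<And>\<psi>. \<psi> a = 1 \<Longrightarrow> (\<And>x. x \<notin> K \<Longrightarrow> \<psi> x = 0) \<Longrightarrow> fin_energy K \<phi> \<le> fin_energy K \<psi>"
    using minimiser[OF fin a] by blast
  have A0: "A \<phi> x = 0" if "x \<in> K" "x \<noteq> a" for x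
    by (rule critical_point[OF fin supp that(1)], simp, rule min)
      (use that \<phi>(1) supp in \<open>auto simp: indicator_def\<close>)
  have pos: "\<phi> x > 0" if "x \<in> K" for x
  proof (rule ccontr)
    assume "\<not> \<phi> x > 0"
    then have x: "\<phi> x = 0" using \<phi>(2)[of x] by simp
    have "K \<subseteq> {y. \<phi> y = 0}"
    proof (rule closed_under_neighbours_connected[OF con \<open>x \<in> K\<close>])
      fix s t assume s: "s \<in> K" "s \<in> {y. \<phi> y = 0}" and st: "b s t > 0"
      then have "A \<phi> s = 0" using A0 \<phi>(1) by force
      then have "0 = \<phi> t"
        using touching_neighbour[OF zero_formal_domain finite_support_formal_domain[where \<phi> = \<phi>, OF fin supp], of s t] \<phi>(2) s st
        by (simp add: A_zero)
      then show "t \<in> {y. \<phi> y = 0}" by simp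
    qed (use x in auto)
    then show False using a \<phi>(1) by auto
  qed
  have "fin_energy K \<phi> = (\<Sum>x\<in>K. if x = a then A \<phi> a else 0)"
    by (subst euler[OF fin]) (use supp A0 \<phi>(1) in \<open>auto intro!: sum.cong\<close>)
  then have "A \<phi> a = energy p b c \<phi>"
    using fin a by (simp add: energy_finite_support[where \<phi> = \<phi>, OF fin supp])
  then show thesis
    using that[of \<phi>] \<phi>(1) pos supp A0 min
    by (simp add: energy_finite_support[OF fin])
qed

subsection \<open>Limits along an exhaustion\<close>

text \<open>Paths can be reversed because \<open>b\<close> is symmetric, so reaching every point
  from \<open>a\<close> is enough.\<close>

lemma connected_from:
  assumes "\<And>x. x \<in> S \<Longrightarrow> (\<lambda>s t. s \<in> S \<and> t \<in> S \<and> b s t > 0)\<^sup>*\<^sup>* a x"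
  shows "connected_in b S"
proof -
  have "symp (\<lambda>s t. s \<in> S \<and> t \<in> S \<and> b s t > 0)\<^sup>*\<^sup>*"
    by (rule symp_rtranclp) (auto simp: symp_def b_sym)
  then show ?thesis
    using assms unfolding connected_in_def by (meson rtranclp_trans sympD)
qed

lemma finite_connected_through:
  obtains P where "finite P" "connected_in b P" "a \<in> P" "x \<in> P"
proof -
  have "(\<lambda>s t. s \<in> UNIV \<and> t \<in> UNIV \<and> b s t > 0)\<^sup>*\<^sup>* a x"
    using conn by (auto simp: connected_in_def)
  then have "\<exists>P. finite P \<and> connected_in b P \<and> a \<in> P \<and> x \<in> P"
  proof induction
    case base
    show ?case by (rule exI[of _ "{a}"]) (auto simp: connected_in_def)
  next
    case (step y z)
    then obtain P where P: "finite P" "connected_in b P" "a \<in> P" "y \<in> P" by blast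
    let ?r = "\<lambda>S s t. s \<in> S \<and> t \<in> S \<and> b s t > 0"
    have mono: "(?r P)\<^sup>*\<^sup>* s t \<Longrightarrow> (?r (insert z P))\<^sup>*\<^sup>* s t" for s t
      by (erule rtranclp_mono[THEN predicate2D, rotated]) auto
    have "(?r (insert z P))\<^sup>*\<^sup>* y w" if "w \<in> insert z P" for w
    proof (cases "w = z")
      case True
      then show ?thesis using step P by (intro r_into_rtranclp) auto
    next
      case False
      then show ?thesis using P(2,4) that mono by (auto simp: connected_in_def)
    qed
    then have "connected_in b (insert z P)" by (rule connected_from)
    then show ?case using P by blast
  qed
  then show thesis using that by blast
qed

lemma exhaustion:
  obtains K :: "nat \<Rightarrow> 'a set" where "\<And>n. finite (K n)" "\<And>n. connected_in b (K n)" "\<And>n. a \<in> K n"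
    "\<And>n k. n \<le> k \<Longrightarrow> K n \<subseteq> K k" "\<And>x. \<exists>n. x \<in> K n"
proof -
  have "\<exists>P. \<forall>x. finite (P x) \<and> connected_in b (P x) \<and> a \<in> P x \<and> x \<in> P x"
    by (rule choice) (metis finite_connected_through)
  then obtain P where P: "\<And>x. finite (P x)" "\<And>x. connected_in b (P x)" "\<And>x. a \<in> P x" "\<And>x. x \<in> P x"
    by blast
  \<comment> \<open>Unite the finite connected sets through the first vertices of an enumeration;
    the union stays connected because all of them contain \<open>a\<close>.\<close>
  define K where "K n = (\<Union>i\<le>n. P (from_nat_into UNIV i))" for n :: nat
  let ?r = "\<lambda>S s t. s \<in> S \<and> t \<in> S \<and> b s t > 0"
  show thesis
  proof (rule that[of K])
    fix n
    show "connected_in b (K n)"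
    proof (rule connected_from)
      fix x assume "x \<in> K n"
      then obtain i where i: "i \<le> n" "x \<in> P (from_nat_into UNIV i)" by (auto simp: K_def)
      have "(?r (P (from_nat_into UNIV i)))\<^sup>*\<^sup>* a x"
        using P(2,3) i(2) by (simp add: connected_in_def)
      then show "(?r (K n))\<^sup>*\<^sup>* a x"
        by (rule rtranclp_mono[THEN predicate2D, rotated]) (use i in \<open>auto simp: K_def\<close>)
    qed
  next
    fix x
    have "x \<in> K (to_nat_on (UNIV :: 'a set) x)"
      using P(4)[of x] countable_UNIV by (auto simp: K_def intro!: bexI[of _ "to_nat_on UNIV x"])
    then show "\<exists>n. x \<in> K n" by blast
  next
    fix n k :: nat assume "n \<le> k"
    then show "K n \<subseteq> K k" by (auto simp: K_def intro: order_trans)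
  qed (use P in \<open>auto simp: K_def\<close>)
qed

section \<open>Local bounds for nonnegative supersolutions\<close>

definition local_mass :: "'a \<Rightarrow> real" where
  "local_mass x = infsum (b x) UNIV + \<bar>c x\<bar>"

text \<open>The modulus of \<open>c\<close> in \<open>local_mass\<close> secures this;
  \<open>harnack\<close> takes a root of the constant.\<close>

lemma local_mass_nonneg: "local_mass x \<ge> 0"
  by (simp add: local_mass_def infsum_nonneg b_nonneg)

text \<open>When \<open>A \<phi> x \<ge> 0\<close>, the flux from larger neighbours is paid for by
  the flux to smaller neighbours and the potential term. As \<open>\<phi>\<close> is nonnegative,
  both are controlled by \<open>\<phi> x powr (p - 1)\<close>.\<close>

lemma upward_flux_le:
  assumes dom: "\<phi> \<in> formal_domain p b {x}" and pos: "\<And>y. \<phi> y \<ge> 0" and A: "A \<phi> x \<ge> 0" and "finite F"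
  shows "(\<Sum>y\<in>F. b x y * (max (\<phi> y - \<phi> x) 0) powr (p - 1)) \<le> local_mass x * \<phi> x powr (p - 1)"
proof -
  \<comment> \<open>A nonnegative majorant of the upward flux whose full sum can be expressed by
    \<open>A \<phi> x\<close>.\<close>
  let ?k = "\<lambda>y. b x y * \<phi> x powr (p - 1) + - (b x y * spow (\<phi> x - \<phi> y) (p - 1))"
  have le: "b x y * (max (\<phi> y - \<phi> x) 0) powr (p - 1) \<le> ?k y" for y
  proof -
    have "(max (\<phi> x - \<phi> y) 0) powr (p - 1) \<le> \<phi> x powr (p - 1)"
      using pos[of x] pos[of y] q_pos by (intro powr_mono2) auto
    then have "(max (\<phi> y - \<phi> x) 0) powr (p - 1) \<le> \<phi> x powr (p - 1) - spow (\<phi> x - \<phi> y) (p - 1)"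
      by (simp add: spow_eq_max)
    from mult_left_mono[OF this b_nonneg[of x y]] show ?thesis by (simp add: right_diff_distrib)
  qed
  have k0: "?k y \<ge> 0" for y
    by (rule order_trans[OF _ le]) (simp add: b_nonneg)
  have s1: "(\<lambda>y. b x y * \<phi> x powr (p - 1)) summable_on UNIV"
    by (intro summable_on_cmult_left b_summable)
  have s2: "(\<lambda>y. - (b x y * spow (\<phi> x - \<phi> y) (p - 1))) summable_on UNIV"
    using flux_summable[OF dom] by (simp add: summable_on_uminus)
  have "infsum ?k UNIV = infsum (b x) UNIV * \<phi> x powr (p - 1) - (A \<phi> x - c x * \<phi> x powr (p - 1))"
    by (subst infsum_add[OF s1 s2])
      (simp add: infsum_uminus A_def spow_nonneg_eq pos infsum_cmult_left')
  also have "\<dots> \<le> local_mass x * \<phi> x powr (p - 1)"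
  proof -
    have "c x * \<phi> x powr (p - 1) \<le> \<bar>c x\<bar> * \<phi> x powr (p - 1)" by (intro mult_right_mono) auto
    then show ?thesis using A by (simp add: local_mass_def distrib_right)
  qed
  finally have "infsum ?k UNIV \<le> local_mass x * \<phi> x powr (p - 1)" .
  moreover have "sum ?k F \<le> infsum ?k UNIV"
    by (rule finite_sum_le_infsum[OF summable_on_add[OF s1 s2] \<open>finite F\<close>]) (use k0 in auto)
  moreover have "(\<Sum>y\<in>F. b x y * (max (\<phi> y - \<phi> x) 0) powr (p - 1)) \<le> sum ?k F"
    by (rule sum_mono[OF le])
  ultimately show ?thesis by linarith
qed

text \<open>Keep one neighbour in \<open>upward_flux_le\<close> and take the root. The constant does
  not depend on \<open>\<phi>\<close>, so it is uniform along an exhaustion.\<close>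

lemma harnack:
  assumes dom: "\<phi> \<in> formal_domain p b {x}" and pos: "\<And>y. \<phi> y \<ge> 0" and A: "A \<phi> x \<ge> 0" and b: "b x y > 0"
  shows "\<phi> y \<le> (1 + (local_mass x / b x y) powr (1 / (p - 1))) * \<phi> x"
proof (rule ccontr)
  let ?C = "(local_mass x / b x y) powr (1 / (p - 1))"
  assume "\<not> ?thesis"
  then have gt: "?C * \<phi> x < \<phi> y - \<phi> x" by (simp add: algebra_simps)
  have C: "?C * \<phi> x \<ge> 0" using pos by simp
  have "(?C * \<phi> x) powr (p - 1) < (\<phi> y - \<phi> x) powr (p - 1)"
    by (rule powr_less_mono2[OF q_pos C gt])
  moreover have "(?C * \<phi> x) powr (p - 1) = local_mass x / b x y * \<phi> x powr (p - 1)"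
    using q_pos local_mass_nonneg[of x] b by (simp add: powr_mult powr_powr)
  ultimately have "local_mass x / b x y * \<phi> x powr (p - 1) < (\<phi> y - \<phi> x) powr (p - 1)"
    by simp
  then have "local_mass x * \<phi> x powr (p - 1) < b x y * (\<phi> y - \<phi> x) powr (p - 1)"
    using b by (simp add: field_simps)
  then show False
    using upward_flux_le[OF dom pos A, of "{y}"] gt C by (simp add: max_def)
qed

text \<open>The bound involves \<open>\<phi>\<close> only through its value at \<open>x\<close> and
  is uniform in \<open>F\<close>, so it passes to limits and puts them in the formal domain.\<close>

lemma supersolution_sum_le:
  assumes dom: "\<phi> \<in> formal_domain p b {x}" and pos: "\<And>y. \<phi> y \<ge> 0" and A: "A \<phi> x \<ge> 0" and "finite F"
  shows "(\<Sum>y\<in>F. b x y * \<phi> y powr (p - 1)) \<le> 2 powr (p - 1) * (local_mass x + infsum (b x) UNIV) * \<phi> x powr (p - 1)"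
proof -
  have "b x y * \<phi> y powr (p - 1) \<le> 2 powr (p - 1) *
      (b x y * (max (\<phi> y - \<phi> x) 0) powr (p - 1) + b x y * \<phi> x powr (p - 1))" for y
  proof -
    have "\<phi> y powr (p - 1) \<le> (max (\<phi> y - \<phi> x) 0 + \<phi> x) powr (p - 1)"
      using pos[of y] q_pos by (intro powr_mono2) auto
    also have "\<dots> \<le> 2 powr (p - 1) * ((max (\<phi> y - \<phi> x) 0) powr (p - 1) + \<phi> x powr (p - 1))"
      by (rule powr_sum_le[OF q_pos]) (use pos in auto)
    finally have "\<phi> y powr (p - 1)
      \<le> 2 powr (p - 1) * ((max (\<phi> y - \<phi> x) 0) powr (p - 1) + \<phi> x powr (p - 1))" .
    from mult_left_mono[OF this b_nonneg[of x y]] show ?thesis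
      by (simp add: distrib_left mult.left_commute)
  qed
  then have "(\<Sum>y\<in>F. b x y * \<phi> y powr (p - 1)) \<le> (\<Sum>y\<in>F. 2 powr (p - 1) *
      (b x y * (max (\<phi> y - \<phi> x) 0) powr (p - 1) + b x y * \<phi> x powr (p - 1)))"
    by (rule sum_mono)
  also have "\<dots> = 2 powr (p - 1) * ((\<Sum>y\<in>F. b x y * (max (\<phi> y - \<phi> x) 0) powr (p - 1))
      + sum (b x) F * \<phi> x powr (p - 1))"
    by (simp add: sum_distrib_left sum_distrib_right sum.distrib distrib_left)
  also have "\<dots> \<le> 2 powr (p - 1) * (local_mass x * \<phi> x powr (p - 1) + infsum (b x) UNIV * \<phi> x powr (p - 1))"
    by (intro mult_left_mono add_mono upward_flux_le mult_right_mono finite_sum_le_infsum assms b_summable)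
      (auto simp: b_nonneg)
  finally show ?thesis by (simp add: algebra_simps)
qed

subsection \<open>Minimal growth and capacity\<close>

lemma minimal_growthD:
  assumes "u \<in> minimal_growth p m b c K" "finite K'" "K' \<noteq> {}" "connected_in b K'" "K \<subseteq> K'"
    and "positive_fun v" "superharmonic_on p m b c (- K') v" "\<And>x. x \<in> K' \<Longrightarrow> u x \<le> v x"
  shows "u x \<le> v x"
  using assms unfolding minimal_growth_def by (cases "x \<in> K'") blast+

lemma minimal_growth_scale:
  assumes u: "u \<in> minimal_growth p m b c K" and t: "t > 0"
  shows "(\<lambda>x. t * u x) \<in> minimal_growth p m b c K"
  unfolding minimal_growth_def
proof (intro CollectI conjI allI impI)
  show "positive_fun (\<lambda>x. t * u x)" using u t by (auto simp: minimal_growth_def positive_fun_def)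
  show "harmonic_on p m b c (- K) (\<lambda>x. t * u x)"
    using u t by (auto simp: minimal_growth_def harmonic_on_iff A_scale formal_domain_scale)
next
  fix K' v
  assume *: "finite K' \<and> K' \<noteq> {} \<and> connected_in b K' \<and> K \<subseteq> K' \<and> positive_fun v \<and>
    superharmonic_on p m b c (- K') v \<and> (\<forall>x\<in>K'. t * u x \<le> v x)"
  let ?v = "\<lambda>x. inverse t * v x"
  have "positive_fun ?v" using * t by (auto simp: positive_fun_def)
  moreover have "superharmonic_on p m b c (- K') ?v"
    using * t by (auto simp: superharmonic_on_iff A_scale formal_domain_scale)
  moreover have le: "u x \<le> inverse t * v x \<longleftrightarrow> t * u x \<le> v x" for x
    using t by (simp add: field_simps)
  ultimately have "\<forall>x\<in>- K'. u x \<le> ?v x"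
    using minimal_growthD[OF u, of K' ?v] * by simp
  then show "\<forall>x\<in>- K'. t * u x \<le> v x" by (simp add: le)
qed

lemma positive_superharmonic_pos:
  assumes "positive_fun v" "superharmonic_on p m b c UNIV v"
  shows "v x > 0"
proof -
  obtain z where "v z \<noteq> 0" using assms(1) by (auto simp: positive_fun_def)
  then show ?thesis
    using superharmonic_positive[of v "{}" z x] assms by (auto simp: positive_fun_def superharmonic_on_iff)
qed

lemma capacity_le:
  assumes "\<phi> \<in> Cc" "\<phi> x = 1"
  shows "variational_capacity p b c x \<le> energy p b c \<phi>"
  unfolding variational_capacity_def
  by (rule cInf_lower) (use assms nonneg in \<open>auto simp: bdd_below_def energy_nonneg_def\<close>)

lemma le_capacity:
  assumes "\<And>\<phi>. \<phi> \<in> Cc \<Longrightarrow> \<phi> x = 1 \<Longrightarrow> e \<le> energy p b c \<phi>"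
  shows "e \<le> variational_capacity p b c x"
proof -
  have "indicator {x} \<in> (Cc :: ('a \<Rightarrow> real) set)" by (simp add: Cc_def indicator_def)
  then show ?thesis
    unfolding variational_capacity_def
    by (intro cInf_greatest) (use assms in \<open>auto intro: exI[of _ "indicator {x}"]\<close>)
qed

lemma capacity_nonneg: "variational_capacity p b c x \<ge> 0"
  by (rule le_capacity) (use nonneg in \<open>auto simp: energy_nonneg_def\<close>)

text \<open>The equation away from \<open>a\<close> survives the limit of the equilibrium potentials
  \<open>g n\<close>. At \<open>a\<close> the right side is the energy of \<open>g n\<close>, which
  tends to the capacity.\<close>

lemma capacity_potential:
  obtains G where "\<And>x. G x > 0" "G \<in> formal_domain p b UNIV" "\<And>x. x \<noteq> a \<Longrightarrow> A G x = 0"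
    "A G a = variational_capacity p b c a" "G \<in> minimal_growth p m b c {a}"
proof -
  obtain K :: "nat \<Rightarrow> 'a set" where K: "\<And>n. finite (K n)" "\<And>n. connected_in b (K n)" "\<And>n. a \<in> K n"
    "\<And>n k. n \<le> k \<Longrightarrow> K n \<subseteq> K k" "\<And>x. \<exists>n. x \<in> K n"
    using exhaustion[of a] by blast
  have "\<exists>g. \<forall>n. g n a = 1 \<and> (\<forall>x\<in>K n. g n x > 0) \<and> (\<forall>x. x \<notin> K n \<longrightarrow> g n x = 0) \<and>
    (\<forall>x\<in>K n. x \<noteq> a \<longrightarrow> A (g n) x = 0) \<and> A (g n) a = energy p b c (g n) \<and>
    (\<forall>\<psi>. \<psi> a = 1 \<longrightarrow> (\<forall>x. x \<notin> K n \<longrightarrow> \<psi> x = 0) \<longrightarrow> energy p b c (g n) \<le> energy p b c \<psi>)"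
  proof (rule choice, rule allI)
    fix n
    show "\<exists>\<phi>. \<phi> a = 1 \<and> (\<forall>x\<in>K n. \<phi> x > 0) \<and> (\<forall>x. x \<notin> K n \<longrightarrow> \<phi> x = 0) \<and>
      (\<forall>x\<in>K n. x \<noteq> a \<longrightarrow> A \<phi> x = 0) \<and> A \<phi> a = energy p b c \<phi> \<and>
      (\<forall>\<psi>. \<psi> a = 1 \<longrightarrow> (\<forall>x. x \<notin> K n \<longrightarrow> \<psi> x = 0) \<longrightarrow> energy p b c \<phi> \<le> energy p b c \<psi>)"
      by (rule equilibrium[OF K(1) K(3) K(2)]) blast
  qed
  then obtain g where ga: "\<And>n. g n a = 1" and gpos: "\<And>n x. x \<in> K n \<Longrightarrow> g n x > 0"
    and gsupp: "\<And>n x. x \<notin> K n \<Longrightarrow> g n x = 0"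
    and gA: "\<And>n x. x \<in> K n \<Longrightarrow> x \<noteq> a \<Longrightarrow> A (g n) x = 0"
    and gAa: "\<And>n. A (g n) a = energy p b c (g n)"
    and gmin: "\<And>n \<psi>. \<psi> a = 1 \<Longrightarrow> (\<And>x. x \<notin> K n \<Longrightarrow> \<psi> x = 0) \<Longrightarrow> energy p b c (g n) \<le> energy p b c \<psi>"
    by metis
  have gdom: "g n \<in> formal_domain p b V" for n V
    by (rule finite_support_formal_domain[OF K(1)]) (use gsupp in auto)
  have g0: "g n x \<ge> 0" for n x using gpos[of x n] gsupp[of x n] by (cases "x \<in> K n") auto
  have gset: "{x. g n x > 0} = K n" for n using gpos gsupp by force
  have energy_g: "energy p b c (g n) \<ge> 0" for n
    by (rule energy_nonneg_support[OF K(1)]) (use gsupp in auto)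
  have gA0: "A (g n) x \<ge> 0" if "x \<in> K n" for n x
    using gA[OF that] gAa[of n] energy_g[of n] by (cases "x = a") auto
  have inc: "incseq (\<lambda>n. g n x)" for x
  proof (rule incseq_SucI)
    fix n
    have sub: "K n \<subseteq> K (Suc n)" by (rule K) simp
    show "g n x \<le> g (Suc n) x"
    \<comment> \<open>The vertex \<open>a\<close>, where both functions equal 1, is left out of the
      comparison set and serves as its exterior point.\<close>
    proof (rule comparison[of "K n - {a}" _ a])
      show "connected_in b {x. g (Suc n) x > 0}" using K(2) by (simp add: gset)
      fix y assume y: "y \<notin> K n - {a}"
      then show "g n y \<le> g (Suc n) y" using ga gsupp[of y n] g0[of "Suc n" y] by (cases "y = a") auto
    qed (use K(1) gpos g0 gdom gA sub ga in auto)
  qed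
  have in_K: "\<exists>N. \<forall>n\<ge>N. x \<in> K n" for x using K(4,5) by blast
  have bdd: "\<exists>M. \<forall>n. g n x \<le> M" for x
  proof -
    have "(\<lambda>s t. s \<in> UNIV \<and> t \<in> UNIV \<and> b s t > 0)\<^sup>*\<^sup>* a x"
      using conn by (auto simp: connected_in_def)
    then show ?thesis
    proof induction
      case base then show ?case using ga by (intro exI[of _ 1]) simp
    next
      case (step y z)
      then obtain M where M: "\<And>n. g n y \<le> M" by blast
      obtain N where N: "\<And>n. n \<ge> N \<Longrightarrow> y \<in> K n" using in_K by blast
      let ?C = "1 + (local_mass y / b y z) powr (1 / (p - 1))"
      have "g n z \<le> ?C * M" for n
      proof -
        \<comment> \<open>The Harnack bound needs \<open>y \<in> K n\<close>; for small
          \<open>n\<close> one moves to a later index and uses monotonicity.\<close>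
        have yK: "y \<in> K (max n N)" by (rule N) simp
        have "g n z \<le> g (max n N) z" by (rule incseqD[OF inc]) simp
        also have "\<dots> \<le> ?C * g (max n N) y"
          using step(2) by (intro harnack gdom g0 gA0 yK) simp
        also have "\<dots> \<le> ?C * M" by (intro mult_left_mono M) (simp add: add_nonneg_nonneg)
        finally show ?thesis .
      qed
      then show ?case by blast
    qed
  qed
  define G where "G x = (SUP n. g n x)" for x
  have lim: "(\<lambda>n. g n x) \<longlonglongrightarrow> G x" for x
    unfolding G_def by (rule LIMSEQ_incseq_SUP[OF _ inc]) (use bdd[of x] in \<open>auto simp: bdd_above_def\<close>)
  have gG: "g n x \<le> G x" for n x by (rule incseq_le[OF inc lim])
  have G0: "G x \<ge> 0" for x using order_trans[OF g0 gG] .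
  have Gpos: "G x > 0" for x
    using K(5)[of x] gpos gG by (meson less_le_trans)
  have Gdom: "G \<in> formal_domain p b UNIV"
  proof -
    have "(\<lambda>y. b x y * G y powr (p - 1)) summable_on UNIV" for x
    proof (rule nonneg_bdd_above_summable_on)
      let ?B = "2 powr (p - 1) * (local_mass x + infsum (b x) UNIV)"
      have B: "?B \<ge> 0" using local_mass_nonneg[of x] by (simp add: infsum_nonneg b_nonneg add_nonneg_nonneg)
      have "(\<Sum>y\<in>F. b x y * G y powr (p - 1)) \<le> ?B * G x powr (p - 1)" if "finite F" for F
      proof (rule LIMSEQ_le_const2)
        show "(\<lambda>n. \<Sum>y\<in>F. b x y * g n y powr (p - 1)) \<longlonglongrightarrow> (\<Sum>y\<in>F. b x y * G y powr (p - 1))"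
          by (intro tendsto_sum tendsto_mult tendsto_const tendsto_powr' lim) (use g0 q_pos in auto)
        obtain N where N: "\<And>n. n \<ge> N \<Longrightarrow> x \<in> K n" using in_K by blast
        have "(\<Sum>y\<in>F. b x y * g n y powr (p - 1)) \<le> ?B * G x powr (p - 1)" if "n \<ge> N" for n
        proof -
          have "(\<Sum>y\<in>F. b x y * g n y powr (p - 1)) \<le> ?B * g n x powr (p - 1)"
            by (rule supersolution_sum_le[OF gdom g0 gA0[OF N[OF that]] \<open>finite F\<close>])
          also have "\<dots> \<le> ?B * G x powr (p - 1)"
            using q_pos by (intro mult_left_mono[OF _ B] powr_mono2 g0 gG) auto
          finally show ?thesis .
        qed
        then show "\<exists>N. \<forall>n\<ge>N. (\<Sum>y\<in>F. b x y * g n y powr (p - 1)) \<le> ?B * G x powr (p - 1)" by blast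
      qed
      then show "bdd_above (sum (\<lambda>y. b x y * G y powr (p - 1)) ` {F. F \<subseteq> UNIV \<and> finite F})"
        by (auto simp: bdd_above_def)
    qed (simp add: b_nonneg)
    then show ?thesis using G0 by (simp add: formal_domain_def)
  qed
  have limA: "(\<lambda>n. A (g n) x) \<longlonglongrightarrow> A G x" for x
    unfolding A_def
  proof (intro tendsto_add tendsto_mult tendsto_const tendsto_spow lim q_pos)
    show "(\<lambda>n. \<Sum>\<^sub>\<infinity>y. b x y * spow (g n x - g n y) (p - 1)) \<longlonglongrightarrow> (\<Sum>\<^sub>\<infinity>y. b x y * spow (G x - G y) (p - 1))"
    proof (rule infsum_dominated_convergence)
      show "(\<lambda>y. 2 powr (p - 1) * (b x y * G x powr (p - 1) + b x y * G y powr (p - 1))) summable_on UNIV"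
        using Gdom G0 by (intro summable_on_cmult_right summable_on_add summable_on_cmult_left b_summable)
          (simp add: formal_domain_def)
      fix n y
      have "\<bar>spow (g n x - g n y) (p - 1)\<bar> \<le> 2 powr (p - 1) * (g n x powr (p - 1) + g n y powr (p - 1))"
        using abs_diff_powr_le[OF q_pos, of "g n x" "g n y"] g0 by (simp add: abs_spow)
      also have "\<dots> \<le> 2 powr (p - 1) * (G x powr (p - 1) + G y powr (p - 1))"
        using q_pos by (intro mult_left_mono add_mono powr_mono2 g0 gG) auto
      finally have "\<bar>spow (g n x - g n y) (p - 1)\<bar>
          \<le> 2 powr (p - 1) * (G x powr (p - 1) + G y powr (p - 1))" .
      from mult_left_mono[OF this b_nonneg[of x y]]
      show "\<bar>b x y * spow (g n x - g n y) (p - 1)\<bar>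
          \<le> 2 powr (p - 1) * (b x y * G x powr (p - 1) + b x y * G y powr (p - 1))"
        by (simp add: abs_mult b_nonneg distrib_left mult.left_commute)
    qed (intro tendsto_intros tendsto_spow lim q_pos)
  qed
  have AG: "A G x = 0" if "x \<noteq> a" for x
  proof -
    obtain N where "\<And>n. n \<ge> N \<Longrightarrow> x \<in> K n" using in_K by blast
    then have "\<forall>\<^sub>F n in sequentially. A (g n) x = 0"
      using gA that by (auto simp: eventually_sequentially)
    then have "(\<lambda>n. A (g n) x) \<longlonglongrightarrow> 0" by (rule tendsto_eventually)
    then show ?thesis by (rule LIMSEQ_unique[OF limA])
  qed
  have AGa: "A G a = variational_capacity p b c a"
  proof (rule antisym)
    show "A G a \<le> variational_capacity p b c a"
    proof (rule le_capacity)
      fix \<phi> :: "'a \<Rightarrow> real" assume \<phi>: "\<phi> \<in> Cc" "\<phi> a = 1"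
      \<comment> \<open>The finite support of a competitor lies in some \<open>K N\<close>, and from
        there on \<open>g n\<close> has no larger energy. Conversely each \<open>g n\<close> is
        itself a competitor for the capacity.\<close>
      have "\<exists>N. F \<subseteq> K N" if "finite F" for F
        using that
      proof induction
        case (insert x F)
        then obtain N M where "F \<subseteq> K N" "x \<in> K M" using K(5) by blast
        then have "insert x F \<subseteq> K (max N M)" using K(4)[of N "max N M"] K(4)[of M "max N M"] by auto
        then show ?case by blast
      qed auto
      then obtain N where N: "{x. \<phi> x \<noteq> 0} \<subseteq> K N" using \<phi> by (auto simp: Cc_def)
      have "A (g n) a \<le> energy p b c \<phi>" if "n \<ge> N" for n
        unfolding gAa by (rule gmin) (use \<phi>(2) N K(4)[OF that] in auto)
      then show "A G a \<le> energy p b c \<phi>" by (intro LIMSEQ_le_const2[OF limA]) blast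
    qed
    have "g n \<in> Cc" for n
      using finite_subset[OF _ K(1)[of n], of "{x. g n x \<noteq> 0}"] gsupp by (auto simp: Cc_def)
    then have "variational_capacity p b c a \<le> A (g n) a" for n
      unfolding gAa by (rule capacity_le) (rule ga)
    then show "variational_capacity p b c a \<le> A G a" by (intro LIMSEQ_le_const[OF limA]) blast
  qed
  have "G \<in> minimal_growth p m b c {a}"
    unfolding minimal_growth_def
  proof (intro CollectI conjI allI impI ballI)
    show "positive_fun G" using Gpos[of a] G0 by (auto simp: positive_fun_def intro!: exI[of _ a])
    show "harmonic_on p m b c (- {a}) G"
      using Gdom AG formal_domain_mono[of "- {a}" UNIV] by (auto simp: harmonic_on_iff)
  next
    fix K' v x
    assume *: "finite K' \<and> K' \<noteq> {} \<and> connected_in b K' \<and> {a} \<subseteq> K' \<and> positive_fun v \<and>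
      superharmonic_on p m b c (- K') v \<and> (\<forall>x\<in>K'. G x \<le> v x)"
    have vdom: "v \<in> formal_domain p b (- K')" and vA: "\<And>x. x \<in> - K' \<Longrightarrow> A v x \<ge> 0"
      and v0: "\<And>x. v x \<ge> 0" and vG: "\<And>x. x \<in> K' \<Longrightarrow> G x \<le> v x"
      using * by (auto simp: superharmonic_on_iff positive_fun_def)
    have vK: "v x > 0" if "x \<in> K'" for x using vG[OF that] Gpos[of x] by linarith
    have aK: "a \<in> K'" using * by auto
    \<comment> \<open>Positivity on \<open>K'\<close> comes from \<open>G\<close>, elsewhere from
      the minimum principle. Then the positivity set of \<open>v\<close> is the whole connected
      graph, and \<open>a\<close>, lying in \<open>K'\<close>, is a point outside
      \<open>K n - K'\<close>.\<close>
    have vpos: "v x > 0" for x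
      by (rule superharmonic_positive[where z = a, OF v0 vdom vA vK]) (use vK[OF aK] in auto)
    have gA': "A (g n) y \<le> 0" if "y \<in> K n - K'" for n y using gA[of y n] that aK by force
    have "g n x \<le> v x" for n
    proof (rule comparison[of "K n - K'" v a])
      show "connected_in b {x. v x > 0}" using conn vpos by simp
      show "v \<in> formal_domain p b (K n - K')" using vdom formal_domain_mono[of "K n - K'" "- K'"] by auto
      fix y assume "y \<notin> K n - K'"
      then show "g n y \<le> v y" using gsupp[of y n] v0[of y] order_trans[OF gG vG, of y n] by auto
    qed (use K(1) vpos v0 aK gdom gA' vA in auto)
    then show "G x \<le> v x" by (intro LIMSEQ_le_const2[OF lim]) blast
  qed
  then show thesis using that[of G] Gpos Gdom AG AGa by blast
qed

text \<open>Scale \<open>v\<close> to agree with \<open>u\<close> at \<open>a\<close>. Minimal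
  growth with the one-point set \<open>{a}\<close> puts \<open>u\<close> below the multiple
  everywhere, and the touching at \<open>a\<close> spreads over the graph. The condition
  \<open>K \<subseteq> {a}\<close> treats potentials with pole \<open>a\<close> and global minimal
  functions together.\<close>

lemma harmonic_minimal_rigid:
  assumes u: "u \<in> minimal_growth p m b c K" "K \<subseteq> {a}" "harmonic_on p m b c UNIV u" "u a > 0"
    and v: "superharmonic_on p m b c UNIV v" "\<And>x. v x > 0"
  shows "u x = u a / v a * v x" "A v x = 0"
proof -
  define t where "t = u a / v a"
  have t: "t > 0" using u(4) v(2) by (simp add: t_def)
  have ta: "t * v a = u a" using v(2)[of a] by (simp add: t_def)
  have udom: "u \<in> formal_domain p b {y}" and Au: "A u y = 0" for y
    using u(3) formal_domain_at by (auto simp: harmonic_on_iff)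
  have vdom: "(\<lambda>z. t * v z) \<in> formal_domain p b UNIV" and Av: "A v y \<ge> 0" for y
    using v(1) formal_domain_scale by (auto simp: superharmonic_on_iff)
  have Atv: "A (\<lambda>z. t * v z) y = t powr (p - 1) * A v y" for y by (rule A_scale[OF t])
  have le: "u y \<le> t * v y" for y
  proof -
    have "superharmonic_on p m b c (- {a}) (\<lambda>z. t * v z)"
      using vdom Av formal_domain_mono[of "- {a}" UNIV] by (auto simp: superharmonic_on_iff Atv)
    moreover have "positive_fun (\<lambda>z. t * v z)"
      using t v(2) by (auto simp: positive_fun_def less_imp_le intro!: exI[of _ a] less_imp_neq[symmetric])
    moreover have "connected_in b {a}" by (auto simp: connected_in_def)
    ultimately show ?thesis
      using minimal_growthD[OF u(1), of "{a}" "\<lambda>z. t * v z"] u(2) ta by simp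
  qed
  have "UNIV \<subseteq> {y. u y = t * v y}"
  proof (rule closed_under_neighbours_connected[OF conn, of a])
    fix r s assume r: "r \<in> {y. u y = t * v y}" and rs: "b r s > 0"
    have "u s = t * v s"
      by (rule touching_neighbour[OF udom formal_domain_at[OF vdom] le]) (use r rs Av in \<open>auto simp: Au Atv\<close>)
    then show "s \<in> {y. u y = t * v y}" by simp
  qed (use ta in auto)
  then have eq: "u = (\<lambda>y. t * v y)" by auto
  then show "u x = u a / v a * v x" unfolding t_def by metis
  show "A v x = 0" using Au[of x] Atv[of x] t by (simp add: eq)
qed

text \<open>At zero capacity the potential of \<open>a\<close> is harmonic also at \<open>a\<close>,
  so rigidity makes \<open>v\<close> a multiple of it.\<close>

lemma capacity_zero_superharmonic:
  assumes "variational_capacity p b c a = 0"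
    and v: "superharmonic_on p m b c UNIV v" "\<And>x. v x > 0"
  shows "A v x = 0"
proof -
  obtain G where G: "\<And>x. G x > 0" "G \<in> formal_domain p b UNIV" "\<And>x. x \<noteq> a \<Longrightarrow> A G x = 0"
    "A G a = variational_capacity p b c a" "G \<in> minimal_growth p m b c {a}"
    using capacity_potential[of a] by blast
  have "A G y = 0" for y using G(3,4) assms(1) by (cases "y = a") auto
  then show ?thesis
    using harmonic_minimal_rigid(2)[OF G(5) _ _ G(1) v] G(2) by (simp add: harmonic_on_iff)
qed

text \<open>The potential \<open>G\<close> of \<open>x\<close> is positive and superharmonic, hence
  harmonic, and the defect \<open>A G x\<close> is the capacity at \<open>x\<close>.\<close>

lemma capacity_zero_everywhere:
  assumes "variational_capacity p b c a = 0"
  shows "variational_capacity p b c x = 0"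
proof -
  obtain G where G: "\<And>z. G z > 0" "G \<in> formal_domain p b UNIV" "\<And>z. z \<noteq> x \<Longrightarrow> A G z = 0"
    "A G x = variational_capacity p b c x" "G \<in> minimal_growth p m b c {x}"
    using capacity_potential[of x] by blast
  have "A G z \<ge> 0" for z using G(3,4) capacity_nonneg[of x] by (cases "z = x") auto
  then have "superharmonic_on p m b c UNIV G" using G(2) by (simp add: superharmonic_on_iff)
  then have "A G x = 0" by (rule capacity_zero_superharmonic[OF assms _ G(1)])
  then show ?thesis using G(4) by simp
qed

section \<open>Subcriticality, capacity and Green's functions\<close>

lemma subcritical_iff_capacity: "subcritical p b c \<longleftrightarrow> (\<exists>x. variational_capacity p b c x > 0)"
proof
  assume "subcritical p b c"
  then obtain w where w: "positive_fun w"
    "\<And>\<phi>. \<phi> \<in> Cc \<Longrightarrow> (\<Sum>\<^sub>\<infinity>x. \<bar>\<phi> x\<bar> powr p * w x) \<le> energy p b c \<phi>"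
    by (auto simp: subcritical_def)
  obtain z where z: "w z > 0" using w(1) by (auto simp: positive_fun_def less_le)
  have "w z \<le> variational_capacity p b c z"
  proof (rule le_capacity)
    fix \<phi> :: "'a \<Rightarrow> real" assume \<phi>: "\<phi> \<in> Cc" "\<phi> z = 1"
    have fin: "finite {x. \<phi> x \<noteq> 0}" using \<phi> by (simp add: Cc_def)
    \<comment> \<open>Finite support gives summability, which rules out the default value 0 of
      \<open>infsum\<close> and lets the term at \<open>z\<close> bound the sum from below.\<close>
    have "(\<lambda>x. \<bar>\<phi> x\<bar> powr p * w x) summable_on UNIV"
      using summable_on_cong_neutral[of "{x. \<phi> x \<noteq> 0}" UNIV "\<lambda>x. \<bar>\<phi> x\<bar> powr p * w x" "\<lambda>x. \<bar>\<phi> x\<bar> powr p * w x"]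
        fin by auto
    then have "(\<Sum>x\<in>{z}. \<bar>\<phi> x\<bar> powr p * w x) \<le> (\<Sum>\<^sub>\<infinity>x. \<bar>\<phi> x\<bar> powr p * w x)"
      by (rule finite_sum_le_infsum) (use w(1) in \<open>auto simp: positive_fun_def\<close>)
    then show "w z \<le> energy p b c \<phi>" using w(2)[OF \<phi>(1)] \<phi>(2) by simp
  qed
  then show "\<exists>x. variational_capacity p b c x > 0" using z by (intro exI[of _ z]) linarith
next
  assume "\<exists>x. variational_capacity p b c x > 0"
  then obtain x where x: "variational_capacity p b c x > 0" by blast
  \<comment> \<open>A positive capacity is itself a weight concentrated at \<open>x\<close>: the
    bound for functions with value 1 at \<open>x\<close> extends to all others by
    homogeneity.\<close>
  define w where "w = (\<lambda>y. variational_capacity p b c x * indicator {x} y)"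
  have "(\<Sum>\<^sub>\<infinity>y. \<bar>\<phi> y\<bar> powr p * w y) \<le> energy p b c \<phi>" if \<phi>: "\<phi> \<in> Cc" for \<phi>
  proof -
    define S where "S = {y. \<phi> y \<noteq> 0}"
    have S: "finite S" "\<And>y. y \<notin> S \<Longrightarrow> \<phi> y = 0" using \<phi> by (auto simp: S_def Cc_def)
    have "(\<Sum>\<^sub>\<infinity>y. \<bar>\<phi> y\<bar> powr p * w y) = (\<Sum>\<^sub>\<infinity>y\<in>{x}. \<bar>\<phi> y\<bar> powr p * w y)"
      by (rule infsum_cong_neutral) (auto simp: w_def)
    then have sum: "(\<Sum>\<^sub>\<infinity>y. \<bar>\<phi> y\<bar> powr p * w y) = \<bar>\<phi> x\<bar> powr p * variational_capacity p b c x"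
      by (simp add: w_def)
    show ?thesis
    proof (cases "\<phi> x = 0")
      case True then show ?thesis using nonneg \<phi> unfolding sum by (simp add: energy_nonneg_def)
    next
      case False
      let ?\<psi> = "\<lambda>y. inverse (\<phi> x) * \<phi> y"
      have "?\<psi> \<in> Cc" using S(1) False by (simp add: Cc_def S_def)
      then have "variational_capacity p b c x \<le> energy p b c ?\<psi>"
        by (rule capacity_le) (use False in simp)
      also have "\<dots> = fin_energy S ?\<psi>" by (rule energy_finite_support[OF S(1)]) (use S in auto)
      also have "\<dots> = inverse (\<bar>\<phi> x\<bar> powr p) * energy p b c \<phi>"
        using energy_finite_support[OF S(1), of \<phi>] S(2)
        by (simp only: fin_energy_scale) (simp add: inverse_powr)
      finally show ?thesis unfolding sum using False by (simp add: field_simps)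
    qed
  qed
  moreover have "positive_fun w" using x by (auto simp: w_def positive_fun_def intro!: exI[of _ x])
  ultimately show "subcritical p b c" using nonneg by (auto simp: subcritical_def)
qed

text \<open>The vertex \<open>a\<close> is arbitrary because the capacity vanishes at all vertices
  or at none.\<close>

lemma critical_iff_capacity: "critical p b c \<longleftrightarrow> variational_capacity p b c a = 0"
  using capacity_zero_everywhere[of a] capacity_nonneg nonneg
  by (auto simp: critical_def subcritical_iff_capacity less_le)

text \<open>A Green's function is positive and superharmonic, so at criticality it would be harmonic
  at its pole, where \<open>A u x\<close> is \<open>m x > 0\<close>.\<close>

lemma critical_no_green:
  assumes "critical p b c" shows "\<not> normalised_green p m b c x u"
proof
  assume u: "normalised_green p m b c x u"
  have A: "A u y = m y * indicator {x} y" for y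
    using u m_pos[of y] by (simp add: normalised_green_def schroedinger_op_eq divide_eq_eq mult.commute)
  have sup: "superharmonic_on p m b c UNIV u"
    using u m_pos by (auto simp: normalised_green_def superharmonic_on_iff A less_imp_le)
  moreover have "positive_fun u" using u by (auto simp: normalised_green_def minimal_growth_def)
  ultimately have "A u x = 0"
    using capacity_zero_superharmonic[OF critical_iff_capacity[THEN iffD1, OF assms, of x] sup]
      positive_superharmonic_pos by blast
  then show False using m_pos[of x] by (simp add: A)
qed

lemma green_exists:
  assumes "\<not> critical p b c" shows "\<exists>u. normalised_green p m b c a u"
proof -
  obtain G where G: "\<And>x. G x > 0" "G \<in> formal_domain p b UNIV" "\<And>x. x \<noteq> a \<Longrightarrow> A G x = 0"
    "A G a = variational_capacity p b c a" "G \<in> minimal_growth p m b c {a}"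
    using capacity_potential[of a] by blast
  have cap: "A G a > 0" using assms capacity_nonneg[of a] G(4) by (simp add: critical_iff_capacity[of a] less_le)
  \<comment> \<open>The solution of \<open>t powr (p - 1) * A G a = m a\<close>, which normalises
    the source at \<open>a\<close> to 1.\<close>
  define t where "t = (m a / A G a) powr (1 / (p - 1))"
  have t: "t > 0" using cap m_pos[of a] by (simp add: t_def)
  have "t powr (p - 1) = m a / A G a" using q_pos cap m_pos[of a] by (simp add: t_def powr_powr)
  then have "A (\<lambda>x. t * G x) x = m x * indicator {a} x" for x
    using G(3) cap by (cases "x = a") (auto simp: A_scale[OF t])
  then have "schroedinger_op p m b c (\<lambda>x. t * G x) x = indicator {a} x" for x
    using m_pos[of x] by (simp add: schroedinger_op_eq)
  then have "normalised_green p m b c a (\<lambda>x. t * G x)"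
    using minimal_growth_scale[OF G(5) t] formal_domain_scale[OF G(2)] by (simp add: normalised_green_def)
  then show ?thesis by blast
qed

text \<open>The test set \<open>K'\<close> need not contain the pole \<open>a\<close> of
  \<open>G\<close>. For a vertex \<open>z\<close> in it, rigidity shows that \<open>G\<close> is a
  multiple of the potential \<open>H\<close> of \<open>z\<close>, so \<open>G\<close> has minimal
  growth off \<open>z\<close> too and the comparison for \<open>K'\<close> applies.\<close>

lemma critical_global_minimal:
  assumes "critical p b c" shows "\<exists>u. global_minimal_positive_harmonic p m b c u"
proof -
  obtain a :: 'a where True by blast
  obtain G where G: "\<And>x. G x > 0" "G \<in> formal_domain p b UNIV" "\<And>x. x \<noteq> a \<Longrightarrow> A G x = 0"
    "A G a = variational_capacity p b c a" "G \<in> minimal_growth p m b c {a}"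
    using capacity_potential[of a] by blast
  have "A G y = 0" for y using G(3,4) critical_iff_capacity[of a] assms by (cases "y = a") auto
  then have harm: "harmonic_on p m b c UNIV G" using G(2) by (simp add: harmonic_on_iff)
  have "G \<in> minimal_growth p m b c {}"
    unfolding minimal_growth_def
  proof (intro CollectI conjI allI impI)
    show "positive_fun G" using G(5) by (simp add: minimal_growth_def)
    show "harmonic_on p m b c (- {}) G" using harm by simp
  next
    fix K' v
    assume *: "finite K' \<and> K' \<noteq> {} \<and> connected_in b K' \<and> {} \<subseteq> K' \<and> positive_fun v \<and>
      superharmonic_on p m b c (- K') v \<and> (\<forall>x\<in>K'. G x \<le> v x)"
    then obtain z where z: "z \<in> K'" by blast
    obtain H where H: "\<And>x. H x > 0" "H \<in> formal_domain p b UNIV" "\<And>x. x \<noteq> z \<Longrightarrow> A H x = 0"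
      "A H z = variational_capacity p b c z" "H \<in> minimal_growth p m b c {z}"
      using capacity_potential[of z] by blast
    define t where "t = G a / H a"
    have "A H y = 0" for y using H(3,4) critical_iff_capacity[of z] assms by (cases "y = z") auto
    then have "superharmonic_on p m b c UNIV H" using H(2) by (simp add: superharmonic_on_iff)
    then have "G x = t * H x" for x
      unfolding t_def by (intro harmonic_minimal_rigid(1)[where v = H and a = a, OF G(5) _ harm G(1) _ H(1)]) simp_all
    then have "G = (\<lambda>x. t * H x)" by (rule ext)
    moreover have "t > 0" by (simp add: t_def G(1) H(1))
    ultimately have "G \<in> minimal_growth p m b c {z}" using minimal_growth_scale[OF H(5)] by simp
    then show "\<forall>x\<in>- K'. G x \<le> v x" using * z unfolding minimal_growth_def by auto
  qed
  then show ?thesis by (auto simp: global_minimal_positive_harmonic_def)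
qed

text \<open>Rigidity for \<open>u\<close>, applied to the superharmonic potential \<open>G\<close>
  of any vertex, makes \<open>G\<close> harmonic, which means zero capacity.\<close>

lemma global_minimal_critical:
  assumes "global_minimal_positive_harmonic p m b c u" shows "critical p b c"
proof -
  have u: "u \<in> minimal_growth p m b c {}" using assms by (simp add: global_minimal_positive_harmonic_def)
  then have harm: "harmonic_on p m b c UNIV u" and pos: "positive_fun u" by (auto simp: minimal_growth_def)
  have "superharmonic_on p m b c UNIV u" using harm by (simp add: harmonic_on_iff superharmonic_on_iff)
  then have upos: "u x > 0" for x by (rule positive_superharmonic_pos[OF pos])
  obtain a :: 'a where True by blast
  obtain G where G: "\<And>x. G x > 0" "G \<in> formal_domain p b UNIV" "\<And>x. x \<noteq> a \<Longrightarrow> A G x = 0"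
    "A G a = variational_capacity p b c a" "G \<in> minimal_growth p m b c {a}"
    using capacity_potential[of a] by blast
  have "A G y \<ge> 0" for y using G(3,4) capacity_nonneg[of a] by (cases "y = a") auto
  then have "superharmonic_on p m b c UNIV G" using G(2) by (simp add: superharmonic_on_iff)
  then have "A G a = 0"
    by (intro harmonic_minimal_rigid(2)[where v = G and a = a, OF u _ harm upos _ G(1)]) simp_all
  then show ?thesis using G(4) critical_iff_capacity[of a] by simp
qed

end

theorem theorem2p6:
  fixes p :: real
    and m :: "'a \<Rightarrow> real"
    and b :: "'a \<Rightarrow> 'a \<Rightarrow> real"
    and c :: "'a \<Rightarrow> real"
  assumes "weighted_graph m b"
    and "p > 1"
    and "energy_nonneg p b c"
  shows "(critical p b c \<longleftrightarrow> (\<forall>x. \<not> (\<exists>u. normalised_green p m b c x u)))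
       \<and> (critical p b c \<longleftrightarrow> (\<exists>u. global_minimal_positive_harmonic p m b c u))
       \<and> (critical p b c \<longleftrightarrow> (\<exists>x. variational_capacity p b c x = 0))"
proof -
  interpret nonneg_schroedinger p m b c by unfold_locales fact+
  show ?thesis
  proof (intro conjI)
    show "critical p b c \<longleftrightarrow> (\<forall>x. \<not> (\<exists>u. normalised_green p m b c x u))"
      using critical_no_green green_exists by blast
    show "critical p b c \<longleftrightarrow> (\<exists>u. global_minimal_positive_harmonic p m b c u)"
      using critical_global_minimal global_minimal_critical by blast
    show "critical p b c \<longleftrightarrow> (\<exists>x. variational_capacity p b c x = 0)"
      using critical_iff_capacity by simp
  qed
qed

end
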